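(* Let \[ \mathcal D_\uparrow=\{(\alpha,\beta)\in(-1,\infty)^2:\ |\beta|\leq\tfrac12,\ \alpha^2+3\beta^2\leq1\},\qquad \gamma_n=n+\frac{\alpha+\beta+1}{2}. \] For every $(\alpha,\beta)\in\mathcal D_\uparrow$, every integer $n\geq1$, and every $1\leq k\leq n$, \[ \gamma_n\theta_{n,k}^{(\alpha,\beta)}\leq\gamma_{n+1}\theta_{n+1,k}^{(\alpha,\beta)}. \] Equality occurs for some $n$ and $k$ if and only if $|\alpha|=|\beta|=\frac12$; at these four parameter values it occurs for every $n$ and $k$.
   Context: $P_n^{(\alpha,\beta)}$ denotes the Jacobi polynomial of degree $n$ (orthogonal on $(-1,1)$ with respect to the weight $(1-x)^\alpha(1+x)^\beta$). For $\alpha,\beta>-1$ its $n$ zeros are simple and lie in $(-1,1)$; they are written $\cos\theta_{n,k}^{(\alpha,\beta)}$, $1\le k\le n$, with $0<\theta_{n,1}^{(\alpha,\beta)}<\cdots<\theta_{n,n}^{(\alpha,\beta)}<\pi$. *)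

theory Defs
  imports "HOL-Analysis.Analysis" "HOL-Computational_Algebra.Polynomial"
begin

definition jacobi_weight :: "real \<Rightarrow> real \<Rightarrow> real \<Rightarrow> real" where
  "jacobi_weight \<alpha> \<beta> x = (1 - x) powr \<alpha> * (1 + x) powr \<beta>"

definition jacobi_orthogonal :: "real \<Rightarrow> real \<Rightarrow> nat \<Rightarrow> real poly \<Rightarrow> bool" where
  "jacobi_orthogonal \<alpha> \<beta> n p \<longleftrightarrow>
     (\<forall>q :: real poly. degree q < n \<longrightarrow>
        (LINT x:{-1<..<1}|lborel. poly p x * poly q x * jacobi_weight \<alpha> \<beta> x) = 0)"

text \<open>
  Orthogonality determines the degree-\<open>n\<close> polynomial up to a nonzero factor; the factor is fixed by
  the usual value at 1, which is positive for \<open>\<alpha> > -1\<close>. The description is proper for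
  \<open>\<alpha>, \<beta> > -1\<close>, where the weight is integrable.
\<close>

definition jacobi_poly :: "real \<Rightarrow> real \<Rightarrow> nat \<Rightarrow> real poly" where
  "jacobi_poly \<alpha> \<beta> n =
     (THE p. degree p = n \<and> jacobi_orthogonal \<alpha> \<beta> n p \<and> poly p 1 = (real n + \<alpha>) gchoose n)"

text \<open>
  The \<open>k\<close>-th smallest (counting from \<open>k = 1\<close>) angle in \<open>(0, \<pi>)\<close> whose cosine is a zero. For
  \<open>\<alpha>, \<beta> > -1\<close> there are exactly \<open>n\<close> such angles, so the value is meaningful for \<open>1 \<le> k \<le> n\<close>.
\<close>

definition jacobi_theta :: "real \<Rightarrow> real \<Rightarrow> nat \<Rightarrow> nat \<Rightarrow> real" where
  "jacobi_theta \<alpha> \<beta> n k =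
     sorted_list_of_set {t. 0 < t \<and> t < pi \<and> poly (jacobi_poly \<alpha> \<beta> n) (cos t) = 0} ! (k - 1)"

definition D_up :: "(real \<times> real) set" where
  "D_up = {(\<alpha>, \<beta>). \<alpha> > -1 \<and> \<beta> > -1 \<and> \<bar>\<beta>\<bar> \<le> 1/2 \<and> \<alpha>\<^sup>2 + 3 * \<beta>\<^sup>2 \<le> 1}"

definition jacobi_gamma :: "real \<Rightarrow> real \<Rightarrow> nat \<Rightarrow> real" where
  "jacobi_gamma \<alpha> \<beta> n = real n + (\<alpha> + \<beta> + 1) / 2"

end

theory Submission
  imports Defs "HOL-Real_Asymp.Real_Asymp"
begin

text \<open>
  Let \<open>w\<^sub>n t = sin (t / 2\<gamma>) powr (\<alpha> + 1/2) * cos (t / 2\<gamma>) powr (\<beta> + 1/2) * P\<^sub>n (cos (t / \<gamma>))\<close> with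
  \<open>\<gamma> = \<gamma>\<^sub>n\<close>. Its zeros in \<open>(0, \<gamma>\<^sub>n \<pi>)\<close> are the numbers \<open>\<gamma>\<^sub>n \<theta>\<^sub>n\<^sub>,\<^sub>k\<close>, and Liouville's transformation of the Jacobi
  equation gives
    \<open>w\<^sub>n'' + (1 + G (t / 2\<gamma>\<^sub>n) / t\<^sup>2) w\<^sub>n = 0\<close>, where
    \<open>G \<phi> = \<phi>\<^sup>2 ((1/4 - \<alpha>\<^sup>2) / sin\<^sup>2 \<phi> + (1/4 - \<beta>\<^sup>2) / cos\<^sup>2 \<phi>)\<close>
  (lemma \<open>liouville_second_derivative\<close>). The index \<open>n\<close> enters only through the argument of \<open>G\<close>. If \<open>G\<close>
  increases, then the coefficient decreases with \<open>n\<close>, and by Sturm's comparison theorem the zeros move to the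
  right. Near 0, \<open>G\<close> behaves like a constant plus
  \<open>((1/4 - \<alpha>\<^sup>2) / 3 + (1/4 - \<beta>\<^sup>2)) \<phi>\<^sup>2\<close>, so that \<open>\<alpha>\<^sup>2 + 3 \<beta>\<^sup>2 \<le> 1\<close> is necessary for this; together with
  \<open>\<bar>\<beta>\<bar> \<le> 1/2\<close> it is also sufficient (lemma \<open>potential_strict_mono\<close>, which reduces to the inequality
  \<open>3 (tan \<phi> - \<phi>) < tan\<^sup>3 \<phi>\<close>). The growth of \<open>G\<close> is strict unless \<open>\<bar>\<alpha>\<bar> = \<bar>\<beta>\<bar> = 1/2\<close>, and in that case
  \<open>G = 0\<close>, all \<open>w\<^sub>n\<close> solve \<open>w'' + w = 0\<close> and are proportional to each other.

  The end point 0 is singular. What Sturm's argument needs there is that the Wronskian of \<open>w\<^sub>n\<close> and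
  \<open>w\<^sub>n\<^sub>+\<^sub>1\<close> tends to 0, which holds for all \<open>\<alpha> > -1\<close> since the leading terms cancel
  (lemma \<open>liouville_wronskian_tendsto_0\<close>).

  The Jacobi polynomials are given by orthogonality and a normalisation. To reach the differential
  equation, an eigenfunction of the Jacobi operator of each degree is constructed, self-adjointness
  shows that it is orthogonal, and uniqueness identifies it with the Jacobi polynomial. Orthogonality
  also gives the \<open>n\<close> distinct zeros in \<open>(-1, 1)\<close>.
\<close>

section \<open>Eigenfunctions of the Jacobi operator\<close>

text \<open>
  The second order differential operator
  \<open>(1 - x\<^sup>2) p'' + (\<beta> - \<alpha> - (\<alpha> + \<beta> + 2) x) p'\<close> of the Jacobi equation. Multiplied by the weight
  it takes the divergence form \<open>((1 - x) powr (\<alpha> + 1) * (1 + x) powr (\<beta> + 1) * p')'\<close>, which makes it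
  self-adjoint.
\<close>

definition jacobi_op :: "real \<Rightarrow> real \<Rightarrow> real poly \<Rightarrow> real poly" where
  "jacobi_op \<alpha> \<beta> p =
     [:1, 0, -1:] * pderiv (pderiv p) + [:\<beta> - \<alpha>, -(\<alpha> + \<beta> + 2):] * pderiv p"

definition jacobi_eigenvalue :: "real \<Rightarrow> real \<Rightarrow> nat \<Rightarrow> real" where
  "jacobi_eigenvalue \<alpha> \<beta> n = real n * (real n + \<alpha> + \<beta> + 1)"

text \<open>
  In the monomial basis the operator is upper triangular with diagonal entries
  \<open>- jacobi_eigenvalue \<alpha> \<beta> k\<close>: the coefficient of index \<open>k\<close> of the image involves only those of index
  \<open>k\<close>, \<open>k + 1\<close> and \<open>k + 2\<close>. Both the existence of eigenfunctions and their orthogonality to polynomials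
  of lower degree rest on this shape.
\<close>

lemma coeff_jacobi_op:
  "coeff (jacobi_op \<alpha> \<beta> p) k =
     real (k + 2) * real (k + 1) * coeff p (k + 2) + (\<beta> - \<alpha>) * real (k + 1) * coeff p (k + 1)
     - jacobi_eigenvalue \<alpha> \<beta> k * coeff p k"
proof (cases k)
  case 0
  then show ?thesis
    by (simp add: jacobi_op_def jacobi_eigenvalue_def coeff_pderiv numeral_2_eq_2)
next
  case (Suc j)
  then show ?thesis
    by (cases j) (simp_all add: jacobi_op_def jacobi_eigenvalue_def coeff_pderiv numeral_2_eq_2 algebra_simps)
qed

lemma jacobi_eigenvalue_strict_mono:
  assumes "\<alpha> > -1" "\<beta> > -1" "m < n"
  shows "jacobi_eigenvalue \<alpha> \<beta> m < jacobi_eigenvalue \<alpha> \<beta> n"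
proof -
  have "jacobi_eigenvalue \<alpha> \<beta> n - jacobi_eigenvalue \<alpha> \<beta> m
        = (real n - real m) * (real n + real m + \<alpha> + \<beta> + 1)"
    by (simp add: jacobi_eigenvalue_def algebra_simps)
  also have "\<dots> > 0"
    using assms by (intro mult_pos_pos) linarith+
  finally show ?thesis by simp
qed

text \<open>
  A triangular operator with distinct diagonal entries has an eigenvector for each of them. It is found
  by back substitution: starting from \<open>x ^ n\<close>, the coefficients of index \<open>n - 1\<close>, \<open>n - 2\<close> and so on are
  corrected one at a time, and a correction at index \<open>j\<close> leaves the equations of higher index intact.
\<close>

lemma jacobi_eigenfunction_exists:
  assumes "\<alpha> > -1" "\<beta> > -1"
  obtains p where "degree p = n" "p \<noteq> 0" "jacobi_op \<alpha> \<beta> p = smult (- jacobi_eigenvalue \<alpha> \<beta> n) p"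
proof -
  let ?l = "jacobi_eigenvalue \<alpha> \<beta>"
  have "\<exists>p. degree p \<le> n \<and> coeff p n = 1 \<and>
          (\<forall>k\<ge>n - m. coeff (jacobi_op \<alpha> \<beta> p) k = - ?l n * coeff p k)" if "m \<le> n" for m
    using that
  proof (induction m)
    case 0
    have "coeff (jacobi_op \<alpha> \<beta> (monom 1 n)) k = - ?l n * coeff (monom 1 n) k" if "k \<ge> n" for k
      using that by (simp add: coeff_jacobi_op)
    then show ?case
      by (intro exI[of _ "monom 1 n"]) (auto simp: degree_monom_eq)
  next
    case (Suc m)
    then obtain p where p: "degree p \<le> n" "coeff p n = 1"
        "\<And>k. k \<ge> n - m \<Longrightarrow> coeff (jacobi_op \<alpha> \<beta> p) k = - ?l n * coeff p k"
      by auto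
    define j where "j = n - Suc m"
    have j: "j < n" "n - m = Suc j" using Suc.prems by (auto simp: j_def)
    have ne: "?l n - ?l j \<noteq> 0" using jacobi_eigenvalue_strict_mono[OF assms j(1)] by simp
    \<comment> \<open>This value solves the equation of index \<open>j\<close>, which is linear in the new coefficient.\<close>
    define c where "c = - (coeff (jacobi_op \<alpha> \<beta> p) j + ?l n * coeff p j) / (?l n - ?l j)"
    define q where "q = p + monom c j"
    have cop: "coeff (jacobi_op \<alpha> \<beta> q) k = coeff (jacobi_op \<alpha> \<beta> p) k - (if k = j then ?l j * c else 0)"
      if "k \<ge> j" for k
      using that by (auto simp: coeff_jacobi_op q_def algebra_simps)
    have "degree q \<le> n" using p(1) j(1)
      by (auto simp: q_def intro!: degree_add_le order_trans[OF degree_monom_le])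
    moreover have "coeff q n = 1" using p(2) j(1) by (simp add: q_def)
    moreover have "coeff (jacobi_op \<alpha> \<beta> q) k = - ?l n * coeff q k" if "k \<ge> n - Suc m" for k
    proof (cases "k = j")
      case True
      have "c * (?l n - ?l j) = - (coeff (jacobi_op \<alpha> \<beta> p) j + ?l n * coeff p j)"
        using ne by (simp add: c_def)
      then show ?thesis using cop[of k] True by (simp add: q_def algebra_simps)
    next
      case False
      then have "k \<ge> n - m" "k \<ge> j" using that j by (auto simp: j_def)
      then show ?thesis using cop[of k] p(3)[of k] False by (simp add: q_def)
    qed
    ultimately show ?case by blast
  qed
  from this[of n] obtain p where p: "degree p \<le> n" "coeff p n = 1"
      "\<And>k. coeff (jacobi_op \<alpha> \<beta> p) k = - ?l n * coeff p k" by auto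
  have "degree p = n" using p(1,2) by (intro antisym le_degree) auto
  moreover have "p \<noteq> 0" using p(2) by auto
  moreover have "jacobi_op \<alpha> \<beta> p = smult (- ?l n) p"
    by (rule poly_eqI) (simp add: p(3))
  ultimately show ?thesis by (rule that)
qed

section \<open>The weight and self-adjointness\<close>

text \<open>
  The substitution \<open>t = (1 + x) / 2\<close> turns the weight into a multiple of the integrand of Euler's Beta
  integral.
\<close>

lemma set_integrable_jacobi_weight:
  assumes "\<alpha> > -1" "\<beta> > -1"
  shows "set_integrable lborel {-1<..<1} (jacobi_weight \<alpha> \<beta>)"
proof -
  define f where "f = (\<lambda>t::real. indicator {0..1} t * (t powr \<beta> * (1 - t) powr \<alpha>))"
  have "set_integrable lborel {0..1} (\<lambda>t::real. t powr ((\<beta> + 1) - 1) * (1 - t) powr ((\<alpha> + 1) - 1))"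
    using assms by (intro integrable_Beta) auto
  then have "integrable lborel f"
    by (simp add: set_integrable_def f_def)
  then have "integrable lborel (\<lambda>x. f (1/2 + 1/2 * x))"
    by (intro lborel_integrable_real_affine) auto
  then have "integrable lborel (\<lambda>x. 2 powr (\<alpha> + \<beta>) * f (1/2 + 1/2 * x))"
    by (intro integrable_mult_right)
  also have "(\<lambda>x. 2 powr (\<alpha> + \<beta>) * f (1/2 + 1/2 * x))
      = (\<lambda>x. indicator {-1..1} x *\<^sub>R jacobi_weight \<alpha> \<beta> x)"
  proof
    fix x :: real
    show "2 powr (\<alpha> + \<beta>) * f (1/2 + 1/2 * x) = indicator {-1..1} x *\<^sub>R jacobi_weight \<alpha> \<beta> x"
    proof (cases "x \<in> {-1..1}")
      case True
      have "(1/2 + 1/2 * x) powr \<beta> = (1 + x) powr \<beta> / 2 powr \<beta>"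
        using True by (subst powr_divide[symmetric]) (auto simp: add_divide_distrib)
      moreover have "(1 - (1/2 + 1/2 * x)) powr \<alpha> = (1 - x) powr \<alpha> / 2 powr \<alpha>"
        using True by (subst powr_divide[symmetric]) (auto simp: field_simps)
      ultimately show ?thesis using True
        by (simp add: f_def jacobi_weight_def powr_add)
    next
      case False
      then show ?thesis by (auto simp: f_def indicator_def)
    qed
  qed
  finally have "set_integrable lborel {-1..1} (jacobi_weight \<alpha> \<beta>)"
    by (simp add: set_integrable_def)
  then show ?thesis by (rule set_integrable_subset) auto
qed

lemma borel_measurable_jacobi_weight [measurable]: "jacobi_weight \<alpha> \<beta> \<in> borel_measurable borel"
  unfolding jacobi_weight_def by measurable

lemma borel_measurable_poly [measurable]: "(\<lambda>x. poly (p :: real poly) x) \<in> borel_measurable borel"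
  by (intro borel_measurable_continuous_onI continuous_intros)

lemma set_integrable_poly_jacobi_weight:
  assumes "\<alpha> > -1" "\<beta> > -1"
  shows "set_integrable lborel {-1<..<1} (\<lambda>x. poly p x * jacobi_weight \<alpha> \<beta> x)"
proof -
  have "bounded (poly p ` {-1..1})"
    by (intro compact_imp_bounded compact_continuous_image continuous_intros) auto
  then obtain C where "\<forall>x\<in>{-1..1}. norm (poly p x) \<le> C"
    unfolding bounded_iff by blast
  then have C: "\<bar>poly p x\<bar> \<le> C" if "x \<in> {-1..1}" for x
    using that by simp
  show ?thesis
  proof (rule set_integrable_bound)
    show "set_integrable lborel {-1<..<1} (\<lambda>x. C * jacobi_weight \<alpha> \<beta> x)"
      using set_integrable_jacobi_weight[OF assms] by simp
    show "set_borel_measurable lborel {-1<..<1} (\<lambda>x. poly p x * jacobi_weight \<alpha> \<beta> x)"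
      unfolding set_borel_measurable_def by measurable
    have "\<bar>poly p x\<bar> * jacobi_weight \<alpha> \<beta> x \<le> C * jacobi_weight \<alpha> \<beta> x" if "x \<in> {-1<..<1}" for x
      using C[of x] that by (intro mult_right_mono) (auto simp: jacobi_weight_def)
    moreover have "0 \<le> C" using C[of 0] by simp
    ultimately show "AE x in lborel. x \<in> {-1<..<1} \<longrightarrow>
        norm (poly p x * jacobi_weight \<alpha> \<beta> x) \<le> norm (C * jacobi_weight \<alpha> \<beta> x)"
      by (intro AE_I2) (auto simp: abs_mult jacobi_weight_def)
  qed
qed

text \<open>
  The moment functional of the weight. The inner product of \<open>p\<close> and \<open>q\<close> is its value at \<open>p * q\<close>, so
  that identities between products of polynomials turn into identities between inner products.
\<close>

definition jacobi_integral :: "real \<Rightarrow> real \<Rightarrow> real poly \<Rightarrow> real" where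
  "jacobi_integral \<alpha> \<beta> p = (LINT x:{-1<..<1}|lborel. poly p x * jacobi_weight \<alpha> \<beta> x)"

lemma jacobi_integral_add:
  assumes "\<alpha> > -1" "\<beta> > -1"
  shows "jacobi_integral \<alpha> \<beta> (p + q) = jacobi_integral \<alpha> \<beta> p + jacobi_integral \<alpha> \<beta> q"
  unfolding jacobi_integral_def poly_add distrib_right
  by (intro set_integral_add set_integrable_poly_jacobi_weight assms)

lemma jacobi_integral_smult: "jacobi_integral \<alpha> \<beta> (smult c p) = c * jacobi_integral \<alpha> \<beta> p"
  by (simp add: jacobi_integral_def mult.assoc)

lemma jacobi_orthogonal_iff:
  "jacobi_orthogonal \<alpha> \<beta> n p \<longleftrightarrow> (\<forall>q. degree q < n \<longrightarrow> jacobi_integral \<alpha> \<beta> (p * q) = 0)"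
  by (simp add: jacobi_orthogonal_def jacobi_integral_def)

text \<open>
  The weight is positive on the open interval, so a vanishing integral forces \<open>p\<close> to vanish almost
  everywhere there, whereas a nonzero polynomial has only finitely many roots.
\<close>

lemma jacobi_integral_nonneg_eq_0_imp:
  assumes ab: "\<alpha> > -1" "\<beta> > -1"
    and nonneg: "\<And>x. -1 < x \<Longrightarrow> x < 1 \<Longrightarrow> 0 \<le> poly p x"
    and zero: "jacobi_integral \<alpha> \<beta> p = 0"
  shows "p = 0"
proof (rule ccontr)
  assume "p \<noteq> 0"
  let ?f = "\<lambda>x. indicator {-1<..<1} x *\<^sub>R (poly p x * jacobi_weight \<alpha> \<beta> x)"
  have int: "integrable lborel ?f"
    using set_integrable_poly_jacobi_weight[OF ab] by (simp add: set_integrable_def)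
  have "AE x in lborel. 0 \<le> ?f x"
    using nonneg by (intro AE_I2) (auto simp: indicator_def jacobi_weight_def)
  with int zero have ae: "AE x in lborel. ?f x = 0"
    by (simp add: integral_nonneg_eq_0_iff_AE jacobi_integral_def set_lebesgue_integral_def)
  have "AE x in lborel. x \<notin> {x. poly p x = 0}"
    using poly_roots_finite[OF \<open>p \<noteq> 0\<close>]
    by (intro AE_not_in null_setsI) (auto simp: emeasure_lborel_countable countable_finite
        intro!: borel_closed finite_imp_closed)
  with ae have "AE x in lborel. x \<notin> {-1<..<1::real}"
  proof eventually_elim
    case (elim x)
    have "jacobi_weight \<alpha> \<beta> x \<noteq> 0" if "x \<in> {-1<..<1}"
      using that by (auto simp: jacobi_weight_def)
    with elim show ?case by (auto simp: indicator_def)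
  qed
  then have "{-1<..<1::real} \<in> null_sets lborel"
    by (subst AE_iff_null_sets) auto
  then show False by (simp add: null_sets_def)
qed

text \<open>
  The integrand is the derivative of \<open>(1 - x) powr (\<alpha> + 1) * (1 + x) powr (\<beta> + 1) * r\<close>, whose
  boundary values vanish because both exponents are positive.
\<close>

lemma jacobi_integral_divergence_eq_0:
  assumes ab: "\<alpha> > -1" "\<beta> > -1"
  shows "jacobi_integral \<alpha> \<beta> ([:1, 0, -1:] * pderiv r + [:\<beta> - \<alpha>, -(\<alpha> + \<beta> + 2):] * r) = 0"
    (is "jacobi_integral \<alpha> \<beta> ?s = 0")
proof -
  define F where "F x = (1 - x) powr (\<alpha> + 1) * (1 + x) powr (\<beta> + 1) * poly r x" for x
  have "((\<lambda>x. poly ?s x * jacobi_weight \<alpha> \<beta> x) has_integral (F 1 - F (-1))) {-1..1}"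
  proof (rule fundamental_theorem_of_calculus_interior)
    show "continuous_on {-1..1} F"
      unfolding F_def using ab by (auto intro!: continuous_intros continuous_on_powr')
  next
    fix x :: real assume x: "x \<in> {-1<..<1}"
    have "((\<lambda>x. (1 - x) powr (\<alpha> + 1)) has_real_derivative - (\<alpha> + 1) * (1 - x) powr \<alpha>) (at x)"
      using x by (auto intro!: derivative_eq_intros simp: algebra_simps)
    moreover have "((\<lambda>x. (1 + x) powr (\<beta> + 1)) has_real_derivative (\<beta> + 1) * (1 + x) powr \<beta>) (at x)"
      using x by (auto intro!: derivative_eq_intros simp: algebra_simps)
    ultimately have "(F has_real_derivative
       ((- (\<alpha> + 1) * (1 - x) powr \<alpha>) * (1 + x) powr (\<beta> + 1)
         + ((\<beta> + 1) * (1 + x) powr \<beta>) * (1 - x) powr (\<alpha> + 1)) * poly r x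
         + poly (pderiv r) x * ((1 - x) powr (\<alpha> + 1) * (1 + x) powr (\<beta> + 1))) (at x)"
      unfolding F_def by (intro DERIV_mult poly_DERIV)
    moreover have "(1 - x) powr (\<alpha> + 1) = (1 - x) * (1 - x) powr \<alpha>"
      "(1 + x) powr (\<beta> + 1) = (1 + x) * (1 + x) powr \<beta>"
      using x by (simp_all add: powr_add)
    ultimately have "(F has_real_derivative
       ((- (\<alpha> + 1) * (1 - x) powr \<alpha>) * ((1 + x) * (1 + x) powr \<beta>)
         + ((\<beta> + 1) * (1 + x) powr \<beta>) * ((1 - x) * (1 - x) powr \<alpha>)) * poly r x
         + poly (pderiv r) x * (((1 - x) * (1 - x) powr \<alpha>) * ((1 + x) * (1 + x) powr \<beta>))) (at x)"
      by simp
    then have "(F has_real_derivative poly ?s x * jacobi_weight \<alpha> \<beta> x) (at x)"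
      by (simp add: jacobi_weight_def algebra_simps)
    then show "(F has_vector_derivative poly ?s x * jacobi_weight \<alpha> \<beta> x) (at x)"
      by (simp add: has_real_derivative_iff_has_vector_derivative)
  qed simp
  moreover have "F 1 = 0" "F (-1) = 0" by (simp_all add: F_def)
  ultimately have "((\<lambda>x. poly ?s x * jacobi_weight \<alpha> \<beta> x) has_integral 0) {-1<..<1}"
    by (simp add: has_integral_Icc_iff_Ioo)
  then show ?thesis
    unfolding jacobi_integral_def
    by (subst set_borel_integral_eq_integral(2)[OF set_integrable_poly_jacobi_weight[OF ab]])
       (rule integral_unique)
qed

text \<open>
  The difference of the two integrands is the divergence belonging to \<open>r = q p' - p q'\<close>.
\<close>

lemma jacobi_op_self_adjoint:
  assumes "\<alpha> > -1" "\<beta> > -1"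
  shows "jacobi_integral \<alpha> \<beta> (jacobi_op \<alpha> \<beta> p * q) = jacobi_integral \<alpha> \<beta> (p * jacobi_op \<alpha> \<beta> q)"
proof -
  define r where "r = q * pderiv p - p * pderiv q"
  have "A * pderiv r + B * r
      = (A * pderiv (pderiv p) + B * pderiv p) * q - p * (A * pderiv (pderiv q) + B * pderiv q)" for A B
    by (simp add: r_def pderiv_diff pderiv_mult algebra_simps)
  then have "[:1, 0, -1:] * pderiv r + [:\<beta> - \<alpha>, -(\<alpha> + \<beta> + 2):] * r
      = jacobi_op \<alpha> \<beta> p * q + smult (-1) (p * jacobi_op \<alpha> \<beta> q)"
    by (simp only: jacobi_op_def smult_minus_left smult_1_left diff_conv_add_uminus)
  with jacobi_integral_divergence_eq_0[OF assms, of r]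
  have "jacobi_integral \<alpha> \<beta> (jacobi_op \<alpha> \<beta> p * q + smult (-1) (p * jacobi_op \<alpha> \<beta> q)) = 0"
    by (simp only:)
  then show ?thesis
    by (simp add: jacobi_integral_add[OF assms] jacobi_integral_smult del: smult_minus_left smult_1_left)
qed

text \<open>
  By self-adjointness \<open>p\<close> is orthogonal to every eigenfunction with another eigenvalue. Since the
  operator maps \<open>q\<close> to \<open>- jacobi_eigenvalue \<alpha> \<beta> (degree q) * q\<close> plus terms of lower degree, the
  same computation works by induction on the degree of \<open>q\<close> without diagonalising.
\<close>

lemma jacobi_eigenfunction_orthogonal:
  assumes ab: "\<alpha> > -1" "\<beta> > -1"
    and eig: "jacobi_op \<alpha> \<beta> p = smult (- jacobi_eigenvalue \<alpha> \<beta> n) p"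
  shows "jacobi_orthogonal \<alpha> \<beta> n p"
  unfolding jacobi_orthogonal_iff
proof (intro allI impI)
  let ?I = "jacobi_integral \<alpha> \<beta>" and ?l = "jacobi_eigenvalue \<alpha> \<beta>"
  fix q :: "real poly"
  assume "degree q < n"
  then show "?I (p * q) = 0"
  proof (induction "degree q" arbitrary: q rule: less_induct)
    case less
    let ?m = "degree q"
    define s where "s = jacobi_op \<alpha> \<beta> q + smult (?l ?m) q"
    have cs: "coeff s k = 0" if "k \<ge> ?m" for k
      using that by (cases "k = ?m") (simp_all add: s_def coeff_jacobi_op coeff_eq_0)
    have ps: "?I (p * s) = 0"
    proof (cases "s = 0")
      case False
      then have "degree s < ?m" using cs[of "degree s"] by (meson leading_coeff_0_iff not_less)
      with less show ?thesis by auto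
    qed (simp add: jacobi_integral_def)
    have "p * jacobi_op \<alpha> \<beta> q = p * s + smult (- ?l ?m) (p * q)"
      by (simp add: s_def algebra_simps)
    then have "?I (p * jacobi_op \<alpha> \<beta> q) = - ?l ?m * ?I (p * q)"
      using ps by (simp add: jacobi_integral_add[OF ab] jacobi_integral_smult del: smult_minus_left)
    moreover have "?I (jacobi_op \<alpha> \<beta> p * q) = - ?l n * ?I (p * q)"
      unfolding eig mult_smult_left by (rule jacobi_integral_smult)
    ultimately have "(?l n - ?l ?m) * ?I (p * q) = 0"
      using jacobi_op_self_adjoint[OF ab, of p q] by (simp add: algebra_simps)
    then show ?case
      using jacobi_eigenvalue_strict_mono[OF ab less.prems] by simp
  qed
qed

section \<open>Zeros and uniqueness of orthogonal polynomials\<close>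

lemma no_zero_constant_sign:
  fixes f :: "real \<Rightarrow> real"
  assumes cont: "\<And>t. a < t \<Longrightarrow> t < b \<Longrightarrow> isCont f t"
    and nz: "\<And>t. a < t \<Longrightarrow> t < b \<Longrightarrow> f t \<noteq> 0"
  obtains \<epsilon> :: real where "\<epsilon> = 1 \<or> \<epsilon> = -1" "\<And>t. a < t \<Longrightarrow> t < b \<Longrightarrow> 0 < \<epsilon> * f t"
proof -
  have "(\<forall>t. a < t \<and> t < b \<longrightarrow> f t > 0) \<or> (\<forall>t. a < t \<and> t < b \<longrightarrow> f t < 0)"
  proof (rule ccontr)
    assume "\<not> ?thesis"
    then obtain x y where "a < x" "x < b" "\<not> 0 < f x" "a < y" "y < b" "\<not> f y < 0" by blast
    moreover from this have "f x < 0" "f y > 0" using nz[of x] nz[of y] by auto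
    moreover have "connected (f ` {a<..<b})"
      using cont by (intro connected_continuous_image continuous_at_imp_continuous_on) auto
    ultimately have "0 \<in> f ` {a<..<b}"
      by (intro connectedD_interval[of _ "f x" "f y" 0]) auto
    then show False using nz by auto
  qed
  then show thesis
    using that[of 1] that[of "-1"] by force
qed

text \<open>
  The witness is \<open>\<plusminus>\<close> the product of the factors \<open>x - r\<close> over the roots \<open>r\<close> in the interval at which
  \<open>p\<close> changes sign; it is built by splitting off one root of \<open>p\<close> with its full multiplicity.
\<close>

lemma sign_matching_poly_exists:
  fixes p :: "real poly"
  assumes "p \<noteq> 0"
  shows "\<exists>q. q \<noteq> 0 \<and> degree q \<le> card {x. a < x \<and> x < b \<and> poly p x = 0} \<and>
           (\<forall>x. a < x \<and> x < b \<longrightarrow> 0 \<le> poly (p * q) x)"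
  using assms
proof (induction "degree p" arbitrary: p rule: less_induct)
  case less
  let ?R = "\<lambda>p. {x. a < x \<and> x < b \<and> poly p x = 0}"
  show ?case
  proof (cases "?R p = {}")
    case True
    obtain \<epsilon> :: real where e: "\<epsilon> = 1 \<or> \<epsilon> = -1"
        "\<And>x. a < x \<Longrightarrow> x < b \<Longrightarrow> 0 < \<epsilon> * poly p x"
      using no_zero_constant_sign[of a b "poly p"] True by auto
    then have "0 \<le> poly (p * [:\<epsilon>:]) x" if "a < x" "x < b" for x
      using e(2)[OF that] by simp
    then show ?thesis using e(1) by (intro exI[of _ "[:\<epsilon>:]"]) auto
  next
    case False
    then obtain r where r: "a < r" "r < b" "poly p r = 0" by auto
    let ?k = "order r p"
    obtain g where g: "p = [:-r, 1:] ^ ?k * g" "\<not> [:-r, 1:] dvd g"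
      using order_decomp[OF less.prems] by blast
    have k: "?k > 0" using r(3) less.prems order_root[of p r] by auto
    have g0: "g \<noteq> 0" "poly g r \<noteq> 0" using g(2) by (auto simp: poly_eq_0_iff_dvd)
    have "degree p = ?k + degree g"
      using g0(1) by (subst (1) g(1), subst degree_mult_eq) (auto simp: degree_power_eq)
    then have "degree g < degree p" using k by simp
    from less.hyps[OF this g0(1)] obtain q where q: "q \<noteq> 0" "degree q \<le> card (?R g)"
        "\<And>x. a < x \<Longrightarrow> x < b \<Longrightarrow> 0 \<le> poly (g * q) x" by blast
    have px: "poly p x = (x - r) ^ ?k * poly g x" for x
      by (subst (1) g(1)) (simp add: poly_power)
    have "?R p = insert r (?R g)" using r k by (auto simp: px)
    moreover have fin: "finite (?R g)"
      by (rule finite_subset[OF _ poly_roots_finite[OF g0(1)]]) auto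
    ultimately have card: "card (?R p) = Suc (card (?R g))" using g0(2) by auto
    show ?thesis
    proof (cases "even ?k")
      case True
      have "0 \<le> poly (p * q) x" if "a < x" "x < b" for x
      proof -
        have "poly (p * q) x = (x - r) ^ ?k * poly (g * q) x" by (simp add: px)
        then show ?thesis using q(3)[OF that] zero_le_even_power[OF True, of "x - r"]
          by (simp only: mult_nonneg_nonneg)
      qed
      then show ?thesis using q card by (intro exI[of _ q]) auto
    next
      case False
      have "0 \<le> poly (p * (q * [:-r, 1:])) x" if "a < x" "x < b" for x
      proof -
        have "poly (p * (q * [:-r, 1:])) x = (x - r) ^ Suc ?k * poly (g * q) x"
          by (simp add: px algebra_simps)
        moreover have "0 \<le> (x - r) ^ Suc ?k" using False by (intro zero_le_even_power) auto
        ultimately show ?thesis using q(3)[OF that] by simp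
      qed
      moreover have "degree (q * [:-r, 1:]) = Suc (degree q)"
        using q(1) by (subst degree_mult_eq) auto
      ultimately show ?thesis using q card by (intro exI[of _ "q * [:-r, 1:]"]) auto
    qed
  qed
qed

text \<open>
  With fewer than \<open>n\<close> roots there would be a polynomial \<open>q\<close> of degree below \<open>n\<close> with the same sign as
  \<open>p\<close>, and then \<open>p * q\<close> could not integrate to zero.
\<close>

lemma jacobi_orthogonal_card_roots:
  assumes ab: "\<alpha> > -1" "\<beta> > -1"
    and p: "degree p = n" "p \<noteq> 0" "jacobi_orthogonal \<alpha> \<beta> n p"
  shows "card {x. -1 < x \<and> x < 1 \<and> poly p x = 0} = n"
proof (rule antisym)
  have "card {x. -1 < x \<and> x < 1 \<and> poly p x = 0} \<le> card {x. poly p x = 0}"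
    by (intro card_mono poly_roots_finite p) auto
  then show "card {x. -1 < x \<and> x < 1 \<and> poly p x = 0} \<le> n"
    using card_poly_roots_bound[OF p(2)] p(1) by simp
  show "n \<le> card {x. -1 < x \<and> x < 1 \<and> poly p x = 0}"
  proof (rule ccontr)
    assume less: "\<not> ?thesis"
    obtain q where q: "q \<noteq> 0" "degree q \<le> card {x. -1 < x \<and> x < 1 \<and> poly p x = 0}"
        "\<And>x. -1 < x \<Longrightarrow> x < 1 \<Longrightarrow> 0 \<le> poly (p * q) x"
      using sign_matching_poly_exists[OF p(2)] by blast
    have "jacobi_integral \<alpha> \<beta> (p * q) = 0"
      using p(3) q(2) less by (auto simp: jacobi_orthogonal_iff)
    from jacobi_integral_nonneg_eq_0_imp[OF ab q(3) this] show False
      using p(2) q(1) by simp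
  qed
qed

text \<open>
  All \<open>n\<close> roots are already accounted for inside the open interval.
\<close>

lemma jacobi_orthogonal_endpoint_nonzero:
  assumes ab: "\<alpha> > -1" "\<beta> > -1"
    and p: "degree p = n" "p \<noteq> 0" "jacobi_orthogonal \<alpha> \<beta> n p"
  shows "poly p 1 \<noteq> 0"
proof
  assume "poly p 1 = 0"
  then have sub: "insert 1 {x. -1 < x \<and> x < 1 \<and> poly p x = 0} \<subseteq> {x. poly p x = 0}" by auto
  have fin: "finite {x. -1 < x \<and> x < 1 \<and> poly p x = 0}"
    by (rule finite_subset[OF _ poly_roots_finite[OF p(2)]]) auto
  have "Suc n \<le> card {x. poly p x = 0}"
    using card_mono[OF poly_roots_finite[OF p(2)] sub] fin jacobi_orthogonal_card_roots[OF ab p] by simp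
  then show False using card_poly_roots_bound[OF p(2)] p(1) by simp
qed

text \<open>
  Subtracting a multiple of \<open>p\<close> that cancels the leading coefficient of \<open>q\<close> leaves a polynomial of
  degree below \<open>n\<close> that is orthogonal to itself. The remaining factor is determined by the value at 1.
\<close>

lemma jacobi_orthogonal_unique:
  assumes ab: "\<alpha> > -1" "\<beta> > -1"
    and p: "degree p = n" "p \<noteq> 0" "jacobi_orthogonal \<alpha> \<beta> n p"
    and q: "degree q = n" "jacobi_orthogonal \<alpha> \<beta> n q"
    and eq: "poly p 1 = poly q 1"
  shows "p = q"
proof -
  define c where "c = lead_coeff q / lead_coeff p"
  define d where "d = q + smult (- c) p"
  have cn: "coeff d n = 0" using p(1,2) q(1) by (auto simp: d_def c_def)
  have deg: "degree d \<le> n"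
    using p(1) q(1) unfolding d_def by (intro degree_add_le) auto
  have orth: "jacobi_integral \<alpha> \<beta> (d * r) = 0" if "degree r < n" for r
  proof -
    have "d * r = q * r + smult (- c) (p * r)" by (simp add: d_def algebra_simps)
    then show ?thesis
      using p(3) q(2) that
      by (simp add: jacobi_integral_add[OF ab] jacobi_integral_smult jacobi_orthogonal_iff del: smult_minus_left)
  qed
  have "d = 0"
  proof (rule ccontr)
    assume "d \<noteq> 0"
    then have "degree d < n" using deg cn by (metis leading_coeff_0_iff le_neq_implies_less)
    from orth[OF this] have "d * d = 0"
      by (intro jacobi_integral_nonneg_eq_0_imp[OF ab]) auto
    with \<open>d \<noteq> 0\<close> show False by simp
  qed
  then have qp: "q = smult c p" by (simp add: d_def)
  with eq jacobi_orthogonal_endpoint_nonzero[OF ab p] have "c = 1" by simp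
  with qp show ?thesis by simp
qed

text \<open>
  Existence and uniqueness identify the definite description with the normalised eigenfunction. In
  particular the orthogonal polynomial satisfies the Jacobi differential equation, and this is how it
  is used from here on.
\<close>

lemma jacobi_poly_properties:
  assumes ab: "\<alpha> > -1" "\<beta> > -1"
  shows degree_jacobi_poly: "degree (jacobi_poly \<alpha> \<beta> n) = n"
    and jacobi_poly_nonzero: "jacobi_poly \<alpha> \<beta> n \<noteq> 0"
    and jacobi_op_jacobi_poly: "jacobi_op \<alpha> \<beta> (jacobi_poly \<alpha> \<beta> n)
          = smult (- jacobi_eigenvalue \<alpha> \<beta> n) (jacobi_poly \<alpha> \<beta> n)"
    and jacobi_orthogonal_jacobi_poly: "jacobi_orthogonal \<alpha> \<beta> n (jacobi_poly \<alpha> \<beta> n)"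
proof -
  let ?v = "(real n + \<alpha>) gchoose n" and ?l = "jacobi_eigenvalue \<alpha> \<beta> n"
  have v: "?v \<noteq> 0"
    using ab by (auto simp: gbinomial_prod_rev)
  obtain p where p: "degree p = n" "p \<noteq> 0" "jacobi_op \<alpha> \<beta> p = smult (- ?l) p"
    using jacobi_eigenfunction_exists[OF ab] .
  have orth: "jacobi_orthogonal \<alpha> \<beta> n p" by (rule jacobi_eigenfunction_orthogonal[OF ab p(3)])
  have p1: "poly p 1 \<noteq> 0" by (rule jacobi_orthogonal_endpoint_nonzero[OF ab p(1,2) orth])
  define P where "P = smult (?v / poly p 1) p"
  have P: "degree P = n" "P \<noteq> 0" "poly P 1 = ?v" using p v p1 by (auto simp: P_def)
  have opP: "jacobi_op \<alpha> \<beta> P = smult (- ?l) P"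
  proof -
    have "jacobi_op \<alpha> \<beta> (smult c p) = smult c (jacobi_op \<alpha> \<beta> p)" for c
      by (rule poly_eqI) (simp add: coeff_jacobi_op algebra_simps)
    then show ?thesis by (simp add: P_def p(3) mult.commute)
  qed
  have orthP: "jacobi_orthogonal \<alpha> \<beta> n P" by (rule jacobi_eigenfunction_orthogonal[OF ab opP])
  have "jacobi_poly \<alpha> \<beta> n = P"
    unfolding jacobi_poly_def
  proof (rule the_equality)
    fix q assume "degree q = n \<and> jacobi_orthogonal \<alpha> \<beta> n q \<and> poly q 1 = ?v"
    then show "q = P" using jacobi_orthogonal_unique[OF ab P(1,2) orthP, of q] P(3) by simp
  qed (use P orthP in auto)
  then show "degree (jacobi_poly \<alpha> \<beta> n) = n" "jacobi_poly \<alpha> \<beta> n \<noteq> 0"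
    "jacobi_op \<alpha> \<beta> (jacobi_poly \<alpha> \<beta> n) = smult (- ?l) (jacobi_poly \<alpha> \<beta> n)"
    "jacobi_orthogonal \<alpha> \<beta> n (jacobi_poly \<alpha> \<beta> n)"
    using P opP orthP by simp_all
qed

definition jacobi_angles :: "real \<Rightarrow> real \<Rightarrow> nat \<Rightarrow> real set" where
  "jacobi_angles \<alpha> \<beta> n = {t. 0 < t \<and> t < pi \<and> poly (jacobi_poly \<alpha> \<beta> n) (cos t) = 0}"

lemma jacobi_angles_card:
  assumes "\<alpha> > -1" "\<beta> > -1"
  shows "finite (jacobi_angles \<alpha> \<beta> n)" "card (jacobi_angles \<alpha> \<beta> n) = n"
proof -
  let ?R = "{x. -1 < x \<and> x < 1 \<and> poly (jacobi_poly \<alpha> \<beta> n) x = 0}"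
  have "bij_betw cos (jacobi_angles \<alpha> \<beta> n) ?R"
  proof (rule bij_betwI[where g = arccos])
    show "cos \<in> jacobi_angles \<alpha> \<beta> n \<rightarrow> ?R"
      using cos_monotone_0_pi[of 0] cos_monotone_0_pi[of _ pi]
      by (force simp: jacobi_angles_def)
    show "arccos \<in> ?R \<rightarrow> jacobi_angles \<alpha> \<beta> n"
      by (auto simp: jacobi_angles_def arccos_lt_bounded)
  qed (auto simp: jacobi_angles_def arccos_cos)
  moreover have "card ?R = n"
    by (intro jacobi_orthogonal_card_roots[OF assms] jacobi_poly_properties[OF assms])
  moreover have "finite ?R"
    by (rule finite_subset[OF _ poly_roots_finite[OF jacobi_poly_nonzero[OF assms, of n]]]) auto
  ultimately show "finite (jacobi_angles \<alpha> \<beta> n)" "card (jacobi_angles \<alpha> \<beta> n) = n"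
    by (simp_all add: bij_betw_finite bij_betw_same_card)
qed

text \<open>
  The description of the angles by a sorted list is traded for the two facts that the comparison
  arguments need.
\<close>

lemma jacobi_theta_enumerates:
  assumes "\<alpha> > -1" "\<beta> > -1"
  shows "strict_mono_on {1..n} (jacobi_theta \<alpha> \<beta> n)"
    and "jacobi_theta \<alpha> \<beta> n ` {1..n} = jacobi_angles \<alpha> \<beta> n"
proof -
  let ?xs = "sorted_list_of_set (jacobi_angles \<alpha> \<beta> n)"
  have th: "jacobi_theta \<alpha> \<beta> n k = ?xs ! (k - 1)" for k
    by (simp add: jacobi_theta_def jacobi_angles_def)
  have len: "length ?xs = n" using jacobi_angles_card[OF assms] by simp
  show "strict_mono_on {1..n} (jacobi_theta \<alpha> \<beta> n)"
  proof (rule strict_mono_onI)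
    fix i j assume "i \<in> {1..n}" "j \<in> {1..n}" "i < j"
    then show "jacobi_theta \<alpha> \<beta> n i < jacobi_theta \<alpha> \<beta> n j"
      unfolding th using len
      by (intro sorted_wrt_nth_less[OF strict_sorted_list_of_set]) auto
  qed
  have "jacobi_theta \<alpha> \<beta> n ` {1..n} = (!) ?xs ` ((\<lambda>k. k - 1) ` {1..n})"
    by (simp add: th image_image)
  also have "(\<lambda>k. k - 1) ` {1..n} = {..<n}"
    by (auto simp: image_iff intro!: bexI[of _ "Suc _"])
  also have "(!) ?xs ` {..<n} = set ?xs" using len by (auto simp: set_conv_nth)
  also have "\<dots> = jacobi_angles \<alpha> \<beta> n" using jacobi_angles_card[OF assms] by simp
  finally show "jacobi_theta \<alpha> \<beta> n ` {1..n} = jacobi_angles \<alpha> \<beta> n" .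
qed

section \<open>Sturm comparison with a singular end point\<close>

definition wronskian :: "(real \<Rightarrow> real) \<Rightarrow> (real \<Rightarrow> real) \<Rightarrow> (real \<Rightarrow> real) \<Rightarrow> (real \<Rightarrow> real) \<Rightarrow> real \<Rightarrow> real" where
  "wronskian u u' v v' t = u t * v' t - u' t * v t"

text \<open>
  For two solutions of \<open>u'' + q u = 0\<close> and \<open>v'' + r v = 0\<close> the Wronskian grows at a rate whose sign is
  that of \<open>q - r\<close> wherever \<open>u\<close> and \<open>v\<close> have the same sign.
\<close>

lemma wronskian_derivative:
  assumes "(u has_real_derivative u' t) (at t)" "(v has_real_derivative v' t) (at t)"
    and "(u' has_real_derivative - q * u t) (at t)" "(v' has_real_derivative - r * v t) (at t)"
  shows "(wronskian u u' v v' has_real_derivative (q - r) * (u t * v t)) (at t)"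
  unfolding wronskian_def
  by (rule derivative_eq_intros assms refl)+ (simp add: algebra_simps)

lemma derivative_nonpos_at_right_end:
  fixes f :: "real \<Rightarrow> real"
  assumes "(f has_real_derivative D) (at b)" "f b = 0" "a < b"
    and "\<And>t. a < t \<Longrightarrow> t < b \<Longrightarrow> 0 < f t"
  shows "D \<le> 0"
proof (rule ccontr)
  assume "\<not> D \<le> 0"
  then obtain d where d: "d > 0" "\<And>h. 0 < h \<Longrightarrow> h < d \<Longrightarrow> f (b - h) < f b"
    using DERIV_pos_inc_left[OF assms(1)] by auto
  define h where "h = min (d/2) ((b - a)/2)"
  have "0 < h" "h < d" "a < b - h" "b - h < b"
    using d(1) assms(3) by (auto simp: h_def min_def field_simps)
  with d(2)[of h] assms(2,4) show False by force
qed

lemma derivative_nonneg_at_left_end: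
  fixes f :: "real \<Rightarrow> real"
  assumes "(f has_real_derivative D) (at a)" "f a = 0" "a < b"
    and "\<And>t. a < t \<Longrightarrow> t < b \<Longrightarrow> 0 < f t"
  shows "0 \<le> D"
proof (rule ccontr)
  assume "\<not> 0 \<le> D"
  then obtain d where d: "d > 0" "\<And>h. 0 < h \<Longrightarrow> h < d \<Longrightarrow> f (a + h) < f a"
    using DERIV_neg_dec_right[OF assms(1)] by auto
  define h where "h = min (d/2) ((b - a)/2)"
  have "0 < h" "h < d" "a < a + h" "a + h < b"
    using d(1) assms(3) by (auto simp: h_def min_def field_simps)
  with d(2)[of h] assms(2,4) show False by force
qed

text \<open>
  Sturm's comparison theorem: the solution of the equation with the larger coefficient oscillates faster,
  so it vanishes strictly between consecutive zeros of the other one. The point 0 may be a singular end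
  of both equations, and a vanishing limit of the Wronskian takes the place of a zero of \<open>v\<close> there.

  If \<open>u\<close> had no zero, then after a change of signs both solutions would be positive between \<open>a\<close> and \<open>b\<close>.
  The Wronskian would start at a nonnegative value and increase strictly, but at \<open>b\<close> it equals
  \<open>u b * v' b\<close>, which is at most 0 because \<open>v\<close> decreases to 0 there.
\<close>

lemma sturm_comparison:
  fixes u v u' v' q r :: "real \<Rightarrow> real"
  assumes u: "\<And>t. 0 < t \<Longrightarrow> t < L \<Longrightarrow> (u has_real_derivative u' t) (at t)"
             "\<And>t. 0 < t \<Longrightarrow> t < L \<Longrightarrow> (u' has_real_derivative - q t * u t) (at t)"
    and v: "\<And>t. 0 < t \<Longrightarrow> t < L \<Longrightarrow> (v has_real_derivative v' t) (at t)"
           "\<And>t. 0 < t \<Longrightarrow> t < L \<Longrightarrow> (v' has_real_derivative - r t * v t) (at t)"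
    and less: "\<And>t. 0 < t \<Longrightarrow> t < L \<Longrightarrow> r t < q t"
    and lim: "(wronskian u u' v v' \<longlongrightarrow> 0) (at_right 0)"
    and ab: "0 \<le> a" "a < b" "b < L" "a = 0 \<or> v a = 0" "v b = 0"
    and nz: "\<And>t. a < t \<Longrightarrow> t < b \<Longrightarrow> v t \<noteq> 0"
  shows "\<exists>t. a < t \<and> t < b \<and> u t = 0"
proof (rule ccontr)
  assume "\<not> ?thesis"
  then have nzu: "u t \<noteq> 0" if "a < t" "t < b" for t using that by blast
  have contu: "isCont u t" and contv: "isCont v t" if "0 < t" "t < L" for t
    using u(1) v(1) that by (auto intro: DERIV_isCont)
  obtain \<epsilon> where e: "\<epsilon> = 1 \<or> \<epsilon> = -1" "\<And>t. a < t \<Longrightarrow> t < b \<Longrightarrow> 0 < \<epsilon> * u t"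
    using no_zero_constant_sign[of a b u] contu nzu ab by auto
  obtain \<delta> where d: "\<delta> = 1 \<or> \<delta> = -1" "\<And>t. a < t \<Longrightarrow> t < b \<Longrightarrow> 0 < \<delta> * v t"
    using no_zero_constant_sign[of a b v] contv nz ab by auto
  define W where "W t = \<epsilon> * \<delta> * wronskian u u' v v' t" for t
  have derW: "(W has_real_derivative (q t - r t) * ((\<epsilon> * u t) * (\<delta> * v t))) (at t)"
    if "0 < t" "t < L" for t
    unfolding W_def
    by (rule derivative_eq_intros wronskian_derivative[OF u(1) v(1) u(2) v(2)] that refl)+
       (simp add: algebra_simps)
  have incW: "W s < W t" if "a < s" "s < t" "t \<le> b" for s t
  proof (rule DERIV_pos_imp_increasing_open[OF that(2)])
    fix x assume x: "s < x" "x < t"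
    have "0 < q x - r x" "0 < \<epsilon> * u x" "0 < \<delta> * v x"
      using x that ab less[of x] e(2)[of x] d(2)[of x] by auto
    then have "0 < (q x - r x) * ((\<epsilon> * u x) * (\<delta> * v x))"
      by (intro mult_pos_pos[OF _ mult_pos_pos])
    then show "\<exists>y. (W has_real_derivative y) (at x) \<and> 0 < y"
      using derW[of x] x that ab by auto
  next
    show "continuous_on {s..t} W"
      using derW that ab by (intro DERIV_continuous_on[of _ _ "\<lambda>t. (q t - r t) * ((\<epsilon> * u t) * (\<delta> * v t))"])
        (auto intro: has_field_derivative_at_within)
  qed
  have limW: "(W \<longlongrightarrow> W a) (at_right a)" if "a \<noteq> 0"
  proof -
    have "isCont W a" using derW[of a] that ab by (auto intro: DERIV_isCont)
    then show ?thesis by (auto simp: isCont_def intro: filterlim_at_split[THEN iffD1, THEN conjunct2])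
  qed
  have lim0: "(W \<longlongrightarrow> 0) (at_right 0)"
    unfolding W_def using tendsto_mult_left[OF lim, of "\<epsilon> * \<delta>"] by simp
  \<comment> \<open>At the end points \<open>u\<close> is only known to be a limit of positive values, so it may vanish there.\<close>
  have cu: "0 \<le> \<epsilon> * u t" if "t = a \<and> a \<noteq> 0 \<or> t = b" for t
  proof -
    have t: "0 < t" "t < L" using that ab by auto
    then have lim: "((\<lambda>s. \<epsilon> * u s) \<longlongrightarrow> \<epsilon> * u t) (at t)"
      using contu[of t] by (intro tendsto_intros) (simp add: isCont_def)
    from that show ?thesis
    proof
      assume "t = a \<and> a \<noteq> 0"
      then have "((\<lambda>s. \<epsilon> * u s) \<longlongrightarrow> \<epsilon> * u t) (at_right a)"
        using lim by (auto simp: filterlim_at_split)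
      then show ?thesis
        by (rule tendsto_lowerbound)
           (auto intro!: eventually_at_rightI[OF _ ab(2)] less_imp_le e(2))
    next
      assume "t = b"
      then have "((\<lambda>s. \<epsilon> * u s) \<longlongrightarrow> \<epsilon> * u t) (at_left b)"
        using lim by (auto simp: filterlim_at_split)
      then show ?thesis
        by (rule tendsto_lowerbound)
           (auto intro!: eventually_at_leftI[OF _ ab(2)] less_imp_le e(2))
    qed
  qed
  have Wb: "W b \<le> 0"
  proof -
    have "\<delta> * v' b \<le> 0"
      using ab v(1)[of b] d(2)
      by (intro derivative_nonpos_at_right_end[of "\<lambda>t. \<delta> * v t" _ b a])
         (auto intro!: derivative_eq_intros)
    then have "(\<epsilon> * u b) * (\<delta> * v' b) \<le> 0" using cu[of b] by (simp add: mult_nonneg_nonpos)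
    then show ?thesis using ab by (simp add: W_def wronskian_def mult_ac)
  qed
  have Wa: "\<exists>w\<ge>0. (W \<longlongrightarrow> w) (at_right a)"
  proof (cases "a = 0")
    case True
    with lim0 show ?thesis by auto
  next
    case False
    then have va: "v a = 0" and a: "0 < a" "a < L" using ab by auto
    have "0 \<le> \<delta> * v' a"
      using ab va v(1)[OF a] d(2)
      by (intro derivative_nonneg_at_left_end[of "\<lambda>t. \<delta> * v t" _ a b])
         (auto intro!: derivative_eq_intros)
    then have "0 \<le> (\<epsilon> * u a) * (\<delta> * v' a)" using cu[of a] False by simp
    then have "0 \<le> W a" using va by (simp add: W_def wronskian_def mult_ac)
    then show ?thesis using limW False by auto
  qed
  then obtain w where w: "0 \<le> w" "(W \<longlongrightarrow> w) (at_right a)" by blast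
  define c where "c = (a + b) / 2"
  have c: "a < c" "c < b" using ab by (auto simp: c_def)
  have "w \<le> W c"
    using w(2) by (rule tendsto_upperbound)
      (auto intro!: eventually_at_rightI[OF _ c(1)] less_imp_le incW simp: c less_imp_le)
  also have "W c < W b" using incW[of c b] c by simp
  finally show False using w(1) Wb by simp
qed

text \<open>
  Passing from a set to a larger one can only move an element to a later place in the increasing
  enumeration.
\<close>

lemma enumeration_subset_index_ge:
  fixes x y :: "nat \<Rightarrow> real"
  assumes x: "strict_mono_on {1..n} x" and y: "strict_mono_on {1..m} y"
    and subset: "\<And>i. i \<in> {1..n} \<Longrightarrow> \<exists>j\<in>{1..m}. y j = x i"
    and k: "k \<in> {1..n}"
  shows "\<exists>j\<in>{k..m}. y j = x k"
  using k
proof (induction k)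
  case (Suc k)
  obtain j where j: "j \<in> {1..m}" "y j = x (Suc k)" using subset Suc.prems by blast
  show ?case
  proof (cases "k = 0")
    case False
    then obtain i where i: "i \<in> {k..m}" "y i = x k" using Suc by auto
    have "y i < y j" using i j x Suc.prems False by (simp add: strict_mono_onD)
    then have "i < j" using i j y False strict_mono_on_leD[OF y, of j i] by force
    then show ?thesis using i j by (intro bexI[of _ j]) auto
  qed (use j in auto)
qed simp

text \<open>
  Each new gap between consecutive \<open>y\<close>'s contributes a new \<open>x\<close>, so at least \<open>k\<close> of the \<open>x\<close>'s lie below
  \<open>y k\<close>. This uses the interlacing only below \<open>L\<close>; if \<open>y k\<close> lies beyond \<open>L\<close>, the claim holds because
  every \<open>x\<close> lies below \<open>L\<close>.
\<close>

lemma interlacing_enumerations: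
  fixes x y :: "nat \<Rightarrow> real"
  assumes x: "strict_mono_on {1..n} x" and y: "strict_mono_on {1..m} y"
    and first: "1 \<le> m \<Longrightarrow> y 1 < L \<Longrightarrow> \<exists>j\<in>{1..n}. x j < y 1"
    and between: "\<And>i. 1 \<le> i \<Longrightarrow> Suc i \<le> m \<Longrightarrow> y (Suc i) < L \<Longrightarrow> \<exists>j\<in>{1..n}. y i < x j \<and> x j < y (Suc i)"
    and below: "\<And>i. i \<in> {1..n} \<Longrightarrow> x i < L"
    and k: "k \<in> {1..n}" "k \<le> m"
  shows "x k < y k"
proof (cases "y k < L")
  case True
  \<comment> \<open>A lower bound on the index, instead of a count of the \<open>x\<close>'s below \<open>y k\<close>, is what goes through
    the induction.\<close>
  have "\<exists>j\<in>{k..n}. x j < y k" if "1 \<le> k" "k \<le> m" "y k < L" for k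
    using that
  proof (induction k rule: nat_induct_at_least)
    case (Suc k)
    have "y k < y (Suc k)" using y Suc by (simp add: strict_mono_onD)
    then obtain i where i: "i \<in> {k..n}" "x i < y k" using Suc by auto
    obtain j where j: "j \<in> {1..n}" "y k < x j" "x j < y (Suc k)" using between Suc by blast
    then have "i < j" using i Suc.hyps strict_mono_on_leD[OF x, of j i] by force
    then show ?case using i j by (intro bexI[of _ j]) auto
  qed (use first in auto)
  from this[of k] k True obtain j where "j \<in> {k..n}" "x j < y k" by auto
  moreover from this have "x k \<le> x j" using k strict_mono_on_leD[OF x, of k j] by auto
  ultimately show ?thesis by simp
next
  case False
  then show ?thesis using below[OF k(1)] by simp
qed

section \<open>Liouville normal form of the Jacobi equation\<close>

text \<open>
  The factor that removes the first order term from the Jacobi equation written in the angle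
  \<open>\<theta> = t / \<gamma>\<close>; \<open>log_derivative\<close> below is its logarithmic derivative in \<open>t\<close>.
\<close>

definition amplitude :: "real \<Rightarrow> real \<Rightarrow> real \<Rightarrow> real \<Rightarrow> real" where
  "amplitude \<alpha> \<beta> \<gamma> t = sin (t / (2 * \<gamma>)) powr (\<alpha> + 1/2) * cos (t / (2 * \<gamma>)) powr (\<beta> + 1/2)"

definition log_derivative :: "real \<Rightarrow> real \<Rightarrow> real \<Rightarrow> real \<Rightarrow> real" where
  "log_derivative \<alpha> \<beta> \<gamma> t =
     ((\<alpha> + 1/2) * (cos (t / (2 * \<gamma>)) / sin (t / (2 * \<gamma>)))
       - (\<beta> + 1/2) * (sin (t / (2 * \<gamma>)) / cos (t / (2 * \<gamma>)))) / (2 * \<gamma>)"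

definition liouville :: "real \<Rightarrow> real \<Rightarrow> real \<Rightarrow> real poly \<Rightarrow> real \<Rightarrow> real" where
  "liouville \<alpha> \<beta> \<gamma> p t = amplitude \<alpha> \<beta> \<gamma> t * poly p (cos (t / \<gamma>))"

definition liouville' :: "real \<Rightarrow> real \<Rightarrow> real \<Rightarrow> real poly \<Rightarrow> real \<Rightarrow> real" where
  "liouville' \<alpha> \<beta> \<gamma> p t = amplitude \<alpha> \<beta> \<gamma> t *
     (log_derivative \<alpha> \<beta> \<gamma> t * poly p (cos (t / \<gamma>)) - sin (t / \<gamma>) / \<gamma> * poly (pderiv p) (cos (t / \<gamma>)))"

text \<open>
  With \<open>\<phi> = t / (2 * \<gamma>)\<close>, the function \<open>liouville\<close> of a Jacobi polynomial satisfies
  \<open>w'' + (1 + potential \<alpha> \<beta> \<phi> / t\<^sup>2) w = 0\<close>. The factor \<open>\<phi>\<^sup>2\<close> is split off together with \<open>1 / t\<^sup>2\<close> so that the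
  parameter \<open>\<gamma>\<close> enters through \<open>\<phi>\<close> alone.
\<close>

definition potential :: "real \<Rightarrow> real \<Rightarrow> real \<Rightarrow> real" where
  "potential \<alpha> \<beta> \<phi> = \<phi>\<^sup>2 * ((1/4 - \<alpha>\<^sup>2) / (sin \<phi>)\<^sup>2 + (1/4 - \<beta>\<^sup>2) / (cos \<phi>)\<^sup>2)"

lemma half_angle_pos:
  fixes t \<gamma> :: real
  assumes "0 < \<gamma>" "0 < t" "t < \<gamma> * pi"
  shows "0 < sin (t / (2 * \<gamma>))" "0 < cos (t / (2 * \<gamma>))"
proof -
  have *: "0 < t / (2 * \<gamma>)" "t / (2 * \<gamma>) < pi / 2" using assms by (auto simp: field_simps)
  show "0 < sin (t / (2 * \<gamma>))" by (rule sin_gt_zero) (use * in linarith)+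
  show "0 < cos (t / (2 * \<gamma>))" by (rule cos_gt_zero_pi) (use * in linarith)+
qed

lemma amplitude_derivative:
  assumes "0 < \<gamma>" "0 < t" "t < \<gamma> * pi"
  shows "(amplitude \<alpha> \<beta> \<gamma> has_real_derivative
           log_derivative \<alpha> \<beta> \<gamma> t * amplitude \<alpha> \<beta> \<gamma> t) (at t)"
proof -
  define S C where "S = sin (t / (2 * \<gamma>))" and "C = cos (t / (2 * \<gamma>))"
  have SC: "0 < S" "0 < C" using half_angle_pos[OF assms] by (simp_all add: S_def C_def)
  define a b where "a = \<alpha> + 1/2" and "b = \<beta> + 1/2"
  have pow: "x powr (c - 1) = x powr c / x" if "0 < x" for x c :: real
    using that by (simp add: powr_diff)
  have dS: "((\<lambda>t. sin (t / (2 * \<gamma>)) powr a) has_real_derivative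
      a * (S powr a / S) * (C / (2 * \<gamma>))) (at t)"
    unfolding pow[OF SC(1), symmetric] using SC(1) assms(1) unfolding S_def C_def
    by (auto intro!: derivative_eq_intros)
  have dC: "((\<lambda>t. cos (t / (2 * \<gamma>)) powr b) has_real_derivative
      b * (C powr b / C) * (- S / (2 * \<gamma>))) (at t)"
    unfolding pow[OF SC(2), symmetric] using SC(2) assms(1) unfolding S_def C_def
    by (auto intro!: derivative_eq_intros)
  have "a * (S powr a / S) * (C / (2 * \<gamma>)) * C powr b + b * (C powr b / C) * (- S / (2 * \<gamma>)) * S powr a
      = (a * (C / S) - b * (S / C)) / (2 * \<gamma>) * (S powr a * C powr b)"
    by (simp add: diff_divide_distrib algebra_simps)
  with DERIV_mult[OF dS dC] show ?thesis
    by (simp add: amplitude_def [abs_def] log_derivative_def a_def b_def S_def C_def)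
qed

lemma log_derivative_derivative:
  assumes "0 < \<gamma>" "0 < t" "t < \<gamma> * pi"
  shows "(log_derivative \<alpha> \<beta> \<gamma> has_real_derivative
           - ((\<alpha> + 1/2) / (sin (t / (2 * \<gamma>)))\<^sup>2 + (\<beta> + 1/2) / (cos (t / (2 * \<gamma>)))\<^sup>2) / (4 * \<gamma>\<^sup>2)) (at t)"
proof -
  note pos = half_angle_pos[OF assms]
  define S C where "S = sin (t / (2 * \<gamma>))" and "C = cos (t / (2 * \<gamma>))"
  have SC: "0 < S" "0 < C" "S\<^sup>2 + C\<^sup>2 = 1" using pos by (simp_all add: S_def C_def)
  have "((\<lambda>t. cos (t / (2 * \<gamma>)) / sin (t / (2 * \<gamma>))) has_real_derivative
      (- S / (2 * \<gamma>) * S - C * (C / (2 * \<gamma>))) / (S * S)) (at t)"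
    using SC(1) assms(1) unfolding S_def C_def by (auto intro!: derivative_eq_intros)
  also have "(- S / (2 * \<gamma>) * S - C * (C / (2 * \<gamma>))) = - (S\<^sup>2 + C\<^sup>2) / (2 * \<gamma>)"
    using assms(1) by (simp add: field_simps power2_eq_square)
  finally have 1: "((\<lambda>t. cos (t / (2 * \<gamma>)) / sin (t / (2 * \<gamma>))) has_real_derivative
      - 1 / (2 * \<gamma>) / S\<^sup>2) (at t)" unfolding SC(3) by (simp add: power2_eq_square)
  have "((\<lambda>t. sin (t / (2 * \<gamma>)) / cos (t / (2 * \<gamma>))) has_real_derivative
      (C / (2 * \<gamma>) * C - S * (- S / (2 * \<gamma>))) / (C * C)) (at t)"
    using SC(2) assms(1) unfolding S_def C_def by (auto intro!: derivative_eq_intros)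
  also have "C / (2 * \<gamma>) * C - S * (- S / (2 * \<gamma>)) = (S\<^sup>2 + C\<^sup>2) / (2 * \<gamma>)"
    using assms(1) by (simp add: field_simps power2_eq_square)
  finally have 2: "((\<lambda>t. sin (t / (2 * \<gamma>)) / cos (t / (2 * \<gamma>))) has_real_derivative
      1 / (2 * \<gamma>) / C\<^sup>2) (at t)" unfolding SC(3) by (simp add: power2_eq_square)
  have "(log_derivative \<alpha> \<beta> \<gamma> has_real_derivative
       ((\<alpha> + 1/2) * (- 1 / (2 * \<gamma>) / S\<^sup>2) - (\<beta> + 1/2) * (1 / (2 * \<gamma>) / C\<^sup>2)) / (2 * \<gamma>)) (at t)"
    unfolding log_derivative_def [abs_def]
    by (intro DERIV_cdivide DERIV_diff DERIV_cmult 1 2)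
  also have "((\<alpha> + 1/2) * (- 1 / (2 * \<gamma>) / S\<^sup>2) - (\<beta> + 1/2) * (1 / (2 * \<gamma>) / C\<^sup>2)) / (2 * \<gamma>)
      = - ((\<alpha> + 1/2) / S\<^sup>2 + (\<beta> + 1/2) / C\<^sup>2) / (4 * \<gamma>\<^sup>2)"
    using assms(1) SC(1,2) by (simp add: divide_simps) (simp add: algebra_simps power2_eq_square)
  finally show ?thesis by (simp add: S_def C_def)
qed

lemma liouville_derivative:
  assumes "0 < \<gamma>" "0 < t" "t < \<gamma> * pi"
  shows "(liouville \<alpha> \<beta> \<gamma> p has_real_derivative liouville' \<alpha> \<beta> \<gamma> p t) (at t)"
proof -
  have "((\<lambda>t. poly p (cos (t / \<gamma>))) has_real_derivative
      poly (pderiv p) (cos (t / \<gamma>)) * (- sin (t / \<gamma>) / \<gamma>)) (at t)"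
    using assms(1) by (auto intro!: derivative_eq_intros DERIV_chain2[OF poly_DERIV])
  from DERIV_mult[OF amplitude_derivative[OF assms] this] show ?thesis
    unfolding liouville_def [abs_def] liouville'_def
    by (rule DERIV_cong) (simp add: algebra_simps)
qed

text \<open>
  The Liouville normal form of the Jacobi equation. The value of \<open>\<gamma>\<close> is the one that completes the
  square, \<open>jacobi_eigenvalue \<alpha> \<beta> n + (\<alpha> + \<beta> + 1)\<^sup>2 / 4 = \<gamma>\<^sup>2\<close>, and the scaling by \<open>\<gamma>\<close> turns this
  constant into 1.
\<close>

lemma liouville_second_derivative:
  assumes t: "0 < \<gamma>" "0 < t" "t < \<gamma> * pi"
    and g: "\<gamma> = real n + (\<alpha> + \<beta> + 1) / 2"
    and ode: "jacobi_op \<alpha> \<beta> p = smult (- jacobi_eigenvalue \<alpha> \<beta> n) p"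
  shows "(liouville' \<alpha> \<beta> \<gamma> p has_real_derivative
           - (1 + potential \<alpha> \<beta> (t / (2 * \<gamma>)) / t\<^sup>2) * liouville \<alpha> \<beta> \<gamma> p t) (at t)"
proof -
  define S C M A where "S = sin (t / (2 * \<gamma>))" and "C = cos (t / (2 * \<gamma>))"
    and "M = log_derivative \<alpha> \<beta> \<gamma> t" and "A = amplitude \<alpha> \<beta> \<gamma> t"
  define c s where "c = cos (t / \<gamma>)" and "s = sin (t / \<gamma>)"
  define a b where "a = \<alpha> + 1/2" and "b = \<beta> + 1/2"
  define P P1 P2 where "P = poly p c" and "P1 = poly (pderiv p) c" and "P2 = poly (pderiv (pderiv p)) c"
  have SC: "0 < S" "0 < C" "S\<^sup>2 + C\<^sup>2 = 1" using half_angle_pos[OF t] by (simp_all add: S_def C_def)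
  define h where "h = t / (2 * \<gamma>)"
  have half: "t / \<gamma> = 2 * h" by (simp add: h_def)
  have cs: "s = 2 * S * C" "2 * C\<^sup>2 = 1 + c" "2 * S\<^sup>2 = 1 - c"
    unfolding s_def c_def S_def C_def half h_def[symmetric]
    using cos_double_cos[of h] cos_double_sin[of h] by (simp_all add: sin_double sin_squared_eq)
  define M' where "M' = - (a / S\<^sup>2 + b / C\<^sup>2) / (4 * \<gamma>\<^sup>2)"
  have dM: "(log_derivative \<alpha> \<beta> \<gamma> has_real_derivative M') (at t)"
    using log_derivative_derivative[OF t] by (simp add: M'_def a_def b_def S_def C_def)
  have dA: "(amplitude \<alpha> \<beta> \<gamma> has_real_derivative M * A) (at t)"
    using amplitude_derivative[OF t] by (simp add: M_def A_def)
  have dP: "((\<lambda>t. poly q (cos (t / \<gamma>))) has_real_derivative poly (pderiv q) c * (- s / \<gamma>)) (at t)" for q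
    unfolding c_def s_def using t(1)
    by (auto intro!: derivative_eq_intros DERIV_chain2[OF poly_DERIV])
  have ds: "((\<lambda>t. sin (t / \<gamma>) / \<gamma>) has_real_derivative c / \<gamma>\<^sup>2) (at t)"
    unfolding c_def using t(1) by (auto intro!: derivative_eq_intros simp: power2_eq_square)
  have eq1: "(1 - c\<^sup>2) * P2 + (\<beta> - \<alpha> - (\<alpha> + \<beta> + 2) * c) * P1 = - jacobi_eigenvalue \<alpha> \<beta> n * P"
    using arg_cong[OF ode, of "\<lambda>q. poly q c"]
    by (simp add: jacobi_op_def P_def P1_def P2_def algebra_simps power2_eq_square)
  have M: "M = (a * (C / S) - b * (S / C)) / (2 * \<gamma>)"
    by (simp add: M_def log_derivative_def a_def b_def S_def C_def)
  have Ms: "2 * M * s / \<gamma> + c / \<gamma>\<^sup>2 = (\<alpha> - \<beta> + (\<alpha> + \<beta> + 2) * c) / \<gamma>\<^sup>2"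
  proof -
    have "M * s = (2 * a * C\<^sup>2 - 2 * b * S\<^sup>2) / (2 * \<gamma>)"
      using SC(1,2) t(1) by (simp add: M cs(1) field_simps power2_eq_square)
    also have "2 * a * C\<^sup>2 - 2 * b * S\<^sup>2 = a * (1 + c) - b * (1 - c)"
      unfolding cs(2,3)[symmetric] by simp
    finally show ?thesis
      using t(1) by (simp add: a_def b_def field_simps power2_eq_square)
  qed
  have MM: "M\<^sup>2 + M' = (((\<alpha>\<^sup>2 - 1/4) / S\<^sup>2 + (\<beta>\<^sup>2 - 1/4) / C\<^sup>2) - (\<alpha> + \<beta> + 1)\<^sup>2) / (4 * \<gamma>\<^sup>2)"
  proof -
    have "M\<^sup>2 = (a\<^sup>2 * (C\<^sup>2 / S\<^sup>2) - 2 * a * b + b\<^sup>2 * (S\<^sup>2 / C\<^sup>2)) / (4 * \<gamma>\<^sup>2)"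
      using SC(1,2) t(1) by (simp add: M divide_simps) (simp add: algebra_simps power2_eq_square)
    also have "C\<^sup>2 / S\<^sup>2 = 1 / S\<^sup>2 - 1"
      using SC by (simp add: divide_simps)
    also have "S\<^sup>2 / C\<^sup>2 = 1 / C\<^sup>2 - 1"
      using SC by (simp add: divide_simps)
    finally have "M\<^sup>2 + M' = (((a\<^sup>2 - a) / S\<^sup>2 + (b\<^sup>2 - b) / C\<^sup>2) - (a + b)\<^sup>2) / (4 * \<gamma>\<^sup>2)"
      unfolding M'_def by (simp add: diff_divide_distrib add_divide_distrib algebra_simps power2_eq_square)
    moreover have "a\<^sup>2 - a = \<alpha>\<^sup>2 - 1/4" "b\<^sup>2 - b = \<beta>\<^sup>2 - 1/4" "a + b = \<alpha> + \<beta> + 1"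
      by (simp_all add: a_def b_def power2_eq_square algebra_simps)
    ultimately show ?thesis by simp
  qed
  have pot: "potential \<alpha> \<beta> (t / (2 * \<gamma>)) / t\<^sup>2 = ((1/4 - \<alpha>\<^sup>2) / S\<^sup>2 + (1/4 - \<beta>\<^sup>2) / C\<^sup>2) / (4 * \<gamma>\<^sup>2)"
    using t by (simp add: potential_def S_def C_def power_divide power_mult_distrib)
  have gam: "(\<alpha> + \<beta> + 1)\<^sup>2 / (4 * \<gamma>\<^sup>2) + jacobi_eigenvalue \<alpha> \<beta> n / \<gamma>\<^sup>2 = 1"
  proof -
    have "(\<alpha> + \<beta> + 1)\<^sup>2 + 4 * jacobi_eigenvalue \<alpha> \<beta> n = 4 * \<gamma>\<^sup>2"
      by (simp add: g jacobi_eigenvalue_def power2_eq_square algebra_simps)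
    then show ?thesis using t(1) by (simp add: field_simps)
  qed
  have s2: "s\<^sup>2 = 1 - c\<^sup>2" by (simp add: s_def c_def sin_squared_eq)
  let ?D = "M * A * (M * P - s / \<gamma> * P1)
      + (M' * P + P1 * (- s / \<gamma>) * M - (c / \<gamma>\<^sup>2 * P1 + P2 * (- s / \<gamma>) * (s / \<gamma>))) * A"
  have "(liouville' \<alpha> \<beta> \<gamma> p has_real_derivative ?D) (at t)"
    unfolding liouville'_def [abs_def]
    using DERIV_mult[OF dA DERIV_diff[OF DERIV_mult[OF dM dP[of p]] DERIV_mult[OF ds dP[of "pderiv p"]]]]
    by (simp add: M_def A_def P_def P1_def P2_def c_def s_def)
  moreover have "?D = - (1 + potential \<alpha> \<beta> (t / (2 * \<gamma>)) / t\<^sup>2) * (A * P)"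
  proof -
    have "?D = A * ((M\<^sup>2 + M') * P + (s\<^sup>2 / \<gamma>\<^sup>2 * P2 - (2 * M * s / \<gamma> + c / \<gamma>\<^sup>2) * P1))"
      using t(1) by (simp add: field_simps power2_eq_square)
    also have "s\<^sup>2 / \<gamma>\<^sup>2 * P2 - (2 * M * s / \<gamma> + c / \<gamma>\<^sup>2) * P1
        = ((1 - c\<^sup>2) * P2 + (\<beta> - \<alpha> - (\<alpha> + \<beta> + 2) * c) * P1) / \<gamma>\<^sup>2"
      unfolding Ms s2 using t(1) by (simp add: field_simps)
    also have "(1 - c\<^sup>2) * P2 + (\<beta> - \<alpha> - (\<alpha> + \<beta> + 2) * c) * P1 = - jacobi_eigenvalue \<alpha> \<beta> n * P"
      by (rule eq1)
    also have "A * ((M\<^sup>2 + M') * P + - jacobi_eigenvalue \<alpha> \<beta> n * P / \<gamma>\<^sup>2)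
        = A * P * (M\<^sup>2 + M' - jacobi_eigenvalue \<alpha> \<beta> n / \<gamma>\<^sup>2)"
      by (simp add: algebra_simps)
    also have "M\<^sup>2 + M' - jacobi_eigenvalue \<alpha> \<beta> n / \<gamma>\<^sup>2 = - (1 + potential \<alpha> \<beta> (t / (2 * \<gamma>)) / t\<^sup>2)"
      unfolding MM pot using gam
      by (simp add: diff_divide_distrib add_divide_distrib)
    finally show ?thesis by simp
  qed
  ultimately show ?thesis by (simp add: liouville_def A_def P_def c_def)
qed

text \<open>
  The polar part \<open>(\<alpha> + 1/2) / t\<close> does not depend on \<open>\<gamma>\<close>, so it cancels in the Wronskian of two functions
  with different \<open>\<gamma>\<close>.
\<close>

lemma log_derivative_expansion:
  assumes "0 < \<gamma>"
  shows "((\<lambda>t. (log_derivative \<alpha> \<beta> \<gamma> t - (\<alpha> + 1/2) / t) / t)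
           \<longlongrightarrow> - (\<alpha> + 1/2) / (12 * \<gamma>\<^sup>2) - (\<beta> + 1/2) / (4 * \<gamma>\<^sup>2)) (at_right 0)"
proof -
  have 1: "((\<lambda>t. (cos (t / (2 * \<gamma>)) / sin (t / (2 * \<gamma>)) / (2 * \<gamma>) - 1 / t) / t) \<longlongrightarrow> - 1 / (12 * \<gamma>\<^sup>2)) (at_right 0)"
    using assms by (real_asymp, simp add: field_simps power2_eq_square)
  have 2: "((\<lambda>t. sin (t / (2 * \<gamma>)) / cos (t / (2 * \<gamma>)) / (2 * \<gamma>) / t) \<longlongrightarrow> 1 / (4 * \<gamma>\<^sup>2)) (at_right 0)"
    using assms by (real_asymp, simp add: field_simps power2_eq_square)
  show ?thesis
    using tendsto_diff[OF tendsto_mult[OF tendsto_const[of "\<alpha> + 1/2"] 1] tendsto_mult[OF tendsto_const[of "\<beta> + 1/2"] 2]]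
    by (simp add: log_derivative_def algebra_simps diff_divide_distrib add_divide_distrib)
qed

text \<open>
  Each of the two amplitudes is of order \<open>t powr (\<alpha> + 1/2)\<close>. Once the polar parts of the logarithmic
  derivatives have cancelled, what remains of the Wronskian has one more factor \<open>t\<close>, which makes it of
  order \<open>t powr (2 * \<alpha> + 2)\<close> with a positive exponent. For \<open>\<alpha> < -1/2\<close> both functions may be
  unbounded at 0, so the cancellation is essential.
\<close>

lemma liouville_wronskian_tendsto_0:
  assumes "\<alpha> > -1" "0 < \<gamma>" "0 < \<delta>"
  shows "(wronskian (liouville \<alpha> \<beta> \<gamma> p) (liouville' \<alpha> \<beta> \<gamma> p)
            (liouville \<alpha> \<beta> \<delta> q) (liouville' \<alpha> \<beta> \<delta> q) \<longlongrightarrow> 0) (at_right 0)"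
proof -
  \<comment> \<open>These are the factors that have a limit at 0 after powers of \<open>t\<close> have been extracted.\<close>
  define E where "E \<gamma> t = (sin (t / (2 * \<gamma>)) / t) powr (\<alpha> + 1/2) * cos (t / (2 * \<gamma>)) powr (\<beta> + 1/2)"
    for \<gamma> t :: real
  define N where "N \<gamma> t = (log_derivative \<alpha> \<beta> \<gamma> t - (\<alpha> + 1/2) / t) / t" for \<gamma> t
  define P where "P p \<gamma> t = poly p (cos (t / \<gamma>))" for p and \<gamma> t :: real
  define R where "R \<gamma> t = sin (t / \<gamma>) / t / \<gamma>" for \<gamma> t :: real
  have E: "\<exists>l. (E \<gamma> \<longlongrightarrow> l) (at_right 0)" if "0 < \<gamma>" for \<gamma>
  proof -
    have "((\<lambda>t. sin (t / (2 * \<gamma>)) / t) \<longlongrightarrow> 1 / (2 * \<gamma>)) (at_right 0)"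
      using that by (real_asymp, simp add: field_simps)
    moreover have "((\<lambda>t. cos (t / (2 * \<gamma>))) \<longlongrightarrow> 1) (at_right 0)"
      using that by real_asymp
    ultimately have "(E \<gamma> \<longlongrightarrow> (1 / (2 * \<gamma>)) powr (\<alpha> + 1/2) * 1 powr (\<beta> + 1/2)) (at_right 0)"
      unfolding E_def using that by (intro tendsto_mult tendsto_powr tendsto_const) auto
    then show ?thesis by blast
  qed
  have N: "\<exists>l. (N \<gamma> \<longlongrightarrow> l) (at_right 0)" if "0 < \<gamma>" for \<gamma>
    using log_derivative_expansion[OF that] unfolding N_def by blast
  have P: "\<exists>l. (P p \<gamma> \<longlongrightarrow> l) (at_right 0)" if "0 < \<gamma>" for p \<gamma>
  proof -
    have "isCont (P p \<gamma>) 0" unfolding P_def using that by (intro continuous_intros) auto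
    then show ?thesis unfolding isCont_def filterlim_at_split by blast
  qed
  have R: "\<exists>l. (R \<gamma> \<longlongrightarrow> l) (at_right 0)" if "0 < \<gamma>" for \<gamma>
  proof -
    have "(R \<gamma> \<longlongrightarrow> 1 / \<gamma> / \<gamma>) (at_right 0)" unfolding R_def using that
      by (real_asymp, simp add: field_simps)
    then show ?thesis by blast
  qed
  obtain e1 e2 where e: "(E \<gamma> \<longlongrightarrow> e1) (at_right 0)" "(E \<delta> \<longlongrightarrow> e2) (at_right 0)" using E assms by blast
  obtain n1 n2 where n: "(N \<gamma> \<longlongrightarrow> n1) (at_right 0)" "(N \<delta> \<longlongrightarrow> n2) (at_right 0)" using N assms by blast
  obtain r1 r2 where r: "(R \<gamma> \<longlongrightarrow> r1) (at_right 0)" "(R \<delta> \<longlongrightarrow> r2) (at_right 0)" using R assms by blast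
  obtain p1 p2 q1 q2 where p: "(P p \<gamma> \<longlongrightarrow> p1) (at_right 0)" "(P (pderiv p) \<gamma> \<longlongrightarrow> p2) (at_right 0)"
      "(P q \<delta> \<longlongrightarrow> q1) (at_right 0)" "(P (pderiv q) \<delta> \<longlongrightarrow> q2) (at_right 0)" using P assms by meson
  define B where "B t = P p \<gamma> t * (N \<delta> t * P q \<delta> t - R \<delta> t * P (pderiv q) \<delta> t)
      - (N \<gamma> t * P p \<gamma> t - R \<gamma> t * P (pderiv p) \<gamma> t) * P q \<delta> t" for t
  have B: "(B \<longlongrightarrow> p1 * (n2 * q1 - r2 * q2) - (n1 * p1 - r1 * p2) * q1) (at_right 0)"
    unfolding B_def by (intro tendsto_intros n r p)
  have "((\<lambda>t::real. t powr (2 * \<alpha> + 2)) \<longlongrightarrow> 0) (at_right 0)"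
    using assms(1) by real_asymp
  from tendsto_mult[OF this tendsto_mult[OF tendsto_mult[OF e] B]]
  have "((\<lambda>t. t powr (2 * \<alpha> + 2) * (E \<gamma> t * E \<delta> t * B t)) \<longlongrightarrow> 0) (at_right 0)" by simp
  then show ?thesis
  proof (rule Lim_transform_eventually)
    have pos: "0 < min \<gamma> \<delta> * pi" using assms by simp
    show "eventually (\<lambda>t. t powr (2 * \<alpha> + 2) * (E \<gamma> t * E \<delta> t * B t)
        = wronskian (liouville \<alpha> \<beta> \<gamma> p) (liouville' \<alpha> \<beta> \<gamma> p)
            (liouville \<alpha> \<beta> \<delta> q) (liouville' \<alpha> \<beta> \<delta> q) t) (at_right 0)"
    proof (rule eventually_at_rightI[OF _ pos])
      fix t assume "t \<in> {0<..<min \<gamma> \<delta> * pi}"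
      then have t: "0 < t" "t < min \<gamma> \<delta> * pi" by auto
      have "min \<gamma> \<delta> * pi \<le> \<gamma> * pi" "min \<gamma> \<delta> * pi \<le> \<delta> * pi"
        by (simp_all add: mult_right_mono)
      with t have td: "t < \<gamma> * pi" "t < \<delta> * pi" by linarith+
      have A: "amplitude \<alpha> \<beta> \<gamma> t = t powr (\<alpha> + 1/2) * E \<gamma> t"
        if "0 < \<gamma>" "t < \<gamma> * pi" for \<gamma>
        using half_angle_pos(1)[OF that(1) t(1) that(2)] t(1)
        by (simp add: amplitude_def E_def powr_divide)
      have L: "log_derivative \<alpha> \<beta> \<gamma> t = t * N \<gamma> t + (\<alpha> + 1/2) / t" for \<gamma>
        using t(1) by (simp add: N_def)
      have sR: "sin (t / \<gamma>) / \<gamma> = t * R \<gamma> t" for \<gamma>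
        using t(1) by (simp add: R_def)
      have tp: "t powr (2 * \<alpha> + 2) = t powr (\<alpha> + 1/2) * t powr (\<alpha> + 1/2) * t"
      proof -
        have "2 * \<alpha> + 2 = (\<alpha> + 1/2) + (\<alpha> + 1/2) + 1" by simp
        then show ?thesis using t(1) by (simp only: powr_add powr_one)
      qed
      show "t powr (2 * \<alpha> + 2) * (E \<gamma> t * E \<delta> t * B t)
        = wronskian (liouville \<alpha> \<beta> \<gamma> p) (liouville' \<alpha> \<beta> \<gamma> p)
            (liouville \<alpha> \<beta> \<delta> q) (liouville' \<alpha> \<beta> \<delta> q) t"
        unfolding wronskian_def liouville_def liouville'_def A[OF assms(2) td(1)] A[OF assms(3) td(2)]
          L sR B_def tp P_def
        by (simp add: algebra_simps)
    qed
  qed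
qed

section \<open>Monotonicity of the potential\<close>

lemma tan_gt_id:
  assumes "0 < x" "x < pi / 2"
  shows "x < tan x"
proof -
  have "tan 0 - 0 < tan x - x"
  proof (rule DERIV_pos_imp_increasing_open[OF assms(1)])
    fix y assume y: "0 < y" "y < x"
    then have c: "cos y > 0" and s: "sin y > 0" using assms by (auto intro: cos_gt_zero sin_gt_zero)
    have "((\<lambda>x. tan x - x) has_real_derivative (tan y)\<^sup>2) (at y)"
      using c tan_sec[of y] by (auto intro!: derivative_eq_intros simp: power_inverse)
    moreover have "0 < (tan y)\<^sup>2" using c s by (simp add: tan_def)
    ultimately show "\<exists>D. ((\<lambda>x. tan x - x) has_real_derivative D) (at y) \<and> 0 < D" by blast
  next
    show "continuous_on {0..x} (\<lambda>x. tan x - x)"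
    proof -
      have "cos y \<noteq> 0" if "y \<in> {0..x}" for y
        using cos_gt_zero_pi[of y] that assms by auto
      then show ?thesis by (intro continuous_intros) auto
    qed
  qed
  then show ?thesis by simp
qed

text \<open>
  The function \<open>tan ^ 3 - 3 * (tan - id)\<close> vanishes at 0 and has derivative \<open>3 * tan ^ 4\<close>.
\<close>

lemma tan_cube_gt:
  assumes "0 < x" "x < pi / 2"
  shows "3 * (tan x - x) < tan x ^ 3"
proof -
  have "tan 0 ^ 3 - 3 * (tan 0 - 0) < tan x ^ 3 - 3 * (tan x - x)"
  proof (rule DERIV_pos_imp_increasing_open[OF assms(1)])
    fix y assume y: "0 < y" "y < x"
    then have c: "cos y > 0" and s: "sin y > 0" using assms by (auto intro: cos_gt_zero sin_gt_zero)
    have "(tan has_real_derivative 1 + (tan y)\<^sup>2) (at y)"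
      using c tan_sec[of y] by (auto intro!: derivative_eq_intros simp: power_inverse)
    from DERIV_diff[OF DERIV_power[OF this, of 3] DERIV_cmult[OF DERIV_diff[OF this DERIV_ident], of 3]]
    have "((\<lambda>x. tan x ^ 3 - 3 * (tan x - x)) has_real_derivative 3 * tan y ^ 4) (at y)"
      by (rule DERIV_cong) (simp add: algebra_simps eval_nat_numeral)
    moreover have "0 < 3 * tan y ^ 4" using c s by (simp add: tan_def)
    ultimately show "\<exists>D. ((\<lambda>x. tan x ^ 3 - 3 * (tan x - x)) has_real_derivative D) (at y) \<and> 0 < D" by blast
  next
    show "continuous_on {0..x} (\<lambda>x. tan x ^ 3 - 3 * (tan x - x))"
    proof -
      have "cos y \<noteq> 0" if "y \<in> {0..x}" for y
        using cos_gt_zero_pi[of y] that assms by auto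
      then show ?thesis by (intro continuous_intros) auto
    qed
  qed
  then show ?thesis by simp
qed

text \<open>
  Put \<open>A = 1/4 - \<alpha>\<^sup>2\<close> and \<open>B = 1/4 - \<beta>\<^sup>2\<close>. The derivative of the potential is
  \<open>2 z (A h + B k)\<close>, where \<open>h\<close> and \<open>k\<close> tend to \<open>1/3\<close> and 1 at 0. So monotonicity near 0 requires
  \<open>A + 3 B \<ge> 0\<close>, which is the condition \<open>\<alpha>\<^sup>2 + 3 \<beta>\<^sup>2 \<le> 1\<close>. Conversely
  \<open>A h + B k = (A + 3 B) h + B (k - 3 h)\<close>, and both \<open>h\<close> and \<open>k - 3 h\<close> are positive on the whole
  interval. The coefficients vanish together only if \<open>A = B = 0\<close>.
\<close>

lemma potential_strict_mono:
  assumes ab: "\<bar>\<beta>\<bar> \<le> 1/2" "\<alpha>\<^sup>2 + 3 * \<beta>\<^sup>2 \<le> 1" "\<not> (\<bar>\<alpha>\<bar> = 1/2 \<and> \<bar>\<beta>\<bar> = 1/2)"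
    and xy: "0 < x" "x < y" "y < pi / 2"
  shows "potential \<alpha> \<beta> x < potential \<alpha> \<beta> y"
proof -
  define A B where "A = 1/4 - \<alpha>\<^sup>2" and "B = 1/4 - \<beta>\<^sup>2"
  have B: "0 \<le> B" using power_mono[OF ab(1) abs_ge_zero, of 2] by (simp add: B_def power2_eq_square)
  have AB: "0 \<le> A + 3 * B" using ab(2) by (simp add: A_def B_def)
  have ne: "0 < A + 3 * B \<or> 0 < B"
  proof (rule ccontr)
    assume "\<not> ?thesis"
    then have "A = 0" "B = 0" using AB B by auto
    then have "\<alpha>\<^sup>2 = (1/2)\<^sup>2" "\<beta>\<^sup>2 = (1/2)\<^sup>2" by (simp_all add: A_def B_def power2_eq_square)
    then have "\<bar>\<alpha>\<bar> = 1/2" "\<bar>\<beta>\<bar> = 1/2" unfolding power2_eq_iff by auto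
    with ab(3) show False by simp
  qed
  have der: "\<exists>D. (potential \<alpha> \<beta> has_real_derivative D) (at z) \<and> 0 < D" if z: "0 < z" "z < pi / 2" for z
  proof -
    define S C where "S = sin z" and "C = cos z"
    have SC: "0 < S" "0 < C" "S\<^sup>2 + C\<^sup>2 = 1"
      using z by (auto simp: S_def C_def intro: sin_gt_zero cos_gt_zero)
    define h k where "h = (S - z * C) / S ^ 3" and "k = (C + z * S) / C ^ 3"
    have "((\<lambda>z. z\<^sup>2 * (A / (sin z)\<^sup>2 + B / (cos z)\<^sup>2)) has_real_derivative
        2 * z * (A / S\<^sup>2 + B / C\<^sup>2) + (A * (- (2 * S * C)) / (S\<^sup>2 * S\<^sup>2) + B * (2 * C * S) / (C\<^sup>2 * C\<^sup>2)) * z\<^sup>2) (at z)"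
      using SC unfolding S_def C_def by (auto intro!: derivative_eq_intros simp: mult_ac)
    also have "2 * z * (A / S\<^sup>2 + B / C\<^sup>2) + (A * (- (2 * S * C)) / (S\<^sup>2 * S\<^sup>2) + B * (2 * C * S) / (C\<^sup>2 * C\<^sup>2)) * z\<^sup>2
        = 2 * z * (A * h + B * k)"
      using SC(1,2) by (simp add: h_def k_def divide_simps) (simp add: algebra_simps eval_nat_numeral)
    also have "A * h + B * k = (A + 3 * B) * h + B * (k - 3 * h)" by (simp add: algebra_simps)
    finally have D: "(potential \<alpha> \<beta> has_real_derivative 2 * z * ((A + 3 * B) * h + B * (k - 3 * h))) (at z)"
      by (simp add: potential_def [abs_def] A_def B_def)
    have T: "tan z = S / C" by (simp add: tan_def S_def C_def)
    have "z * C < S" using tan_gt_id[OF z] SC by (simp add: T field_simps)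
    then have h: "0 < h" using SC by (simp add: h_def)
    have "3 * (S - z * C) * C\<^sup>2 < S ^ 3"
    proof -
      have "3 * (S / C - z) * C ^ 3 < (S / C) ^ 3 * C ^ 3"
        using tan_cube_gt[OF z] SC(2) by (intro mult_strict_right_mono) (auto simp: T)
      moreover have "3 * (S / C - z) * C ^ 3 = 3 * (S - z * C) * C\<^sup>2"
        using SC(2) by (simp add: field_simps eval_nat_numeral)
      moreover have "(S / C) ^ 3 * C ^ 3 = S ^ 3" using SC(2) by (simp add: power_divide)
      ultimately show ?thesis by simp
    qed
    then have "3 * (S - z * C) * C\<^sup>2 * C < S ^ 3 * C" using SC(2) by simp
    also have "\<dots> \<le> S ^ 3 * (C + z * S)" using SC z by (intro mult_left_mono) auto
    finally have "3 * h < k" using SC by (simp add: h_def k_def field_simps eval_nat_numeral)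
    then have "0 < (A + 3 * B) * h + B * (k - 3 * h)"
      using h ne AB B by (auto intro: add_pos_nonneg add_nonneg_pos)
    then have "0 < 2 * z * ((A + 3 * B) * h + B * (k - 3 * h))"
      using z by (intro mult_pos_pos) auto
    with D show ?thesis by blast
  qed
  show ?thesis
  proof (rule DERIV_pos_imp_increasing[OF xy(2)])
    fix z assume "x \<le> z" "z \<le> y"
    then show "\<exists>D. (potential \<alpha> \<beta> has_real_derivative D) (at z) \<and> 0 < D" using der[of z] xy by auto
  qed
qed

section \<open>Comparison of the scaled zeros\<close>

text \<open>
  The Wronskian is constant, hence zero, so the two solutions are proportional. A solution that is not
  identically zero cannot vanish together with its derivative, because \<open>u\<^sup>2 + u'\<^sup>2\<close> is constant.
\<close>

lemma common_zeros_if_same_equation: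
  fixes u v u' v' :: "real \<Rightarrow> real"
  assumes u: "\<And>t. 0 < t \<Longrightarrow> t < L \<Longrightarrow> (u has_real_derivative u' t) (at t)"
             "\<And>t. 0 < t \<Longrightarrow> t < L \<Longrightarrow> (u' has_real_derivative - u t) (at t)"
    and v: "\<And>t. 0 < t \<Longrightarrow> t < L \<Longrightarrow> (v has_real_derivative v' t) (at t)"
           "\<And>t. 0 < t \<Longrightarrow> t < L \<Longrightarrow> (v' has_real_derivative - v t) (at t)"
    and lim: "(wronskian u u' v v' \<longlongrightarrow> 0) (at_right 0)"
    and nz: "0 < z" "z < L" "u z \<noteq> 0"
    and s: "0 < s" "s < L" "u s = 0"
  shows "v s = 0"
proof -
  have const: "f x = f y"
    if "\<And>t. 0 < t \<Longrightarrow> t < L \<Longrightarrow> (f has_real_derivative 0) (at t)" "0 < x" "x < L" "0 < y" "y < L"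
    for f :: "real \<Rightarrow> real" and x y
  proof -
    have "\<exists>c. \<forall>t\<in>{0<..<L}. f t = c"
    proof (rule has_field_derivative_zero_constant)
      fix t assume "t \<in> {0<..<L}"
      then have "(f has_real_derivative 0) (at t)" by (intro that(1)) auto
      then show "(f has_real_derivative 0) (at t within {0<..<L})"
        by (rule has_field_derivative_at_within)
    qed simp
    then obtain c where "\<forall>t\<in>{0<..<L}. f t = c" by blast
    with that(2-) show ?thesis by simp
  qed
  have W: "(wronskian u u' v v' has_real_derivative 0) (at t)" if t: "0 < t" "t < L" for t
    using wronskian_derivative[of u u' t v v' 1 1, OF u(1)[OF t] v(1)[OF t]] u(2)[OF t] v(2)[OF t]
    by simp
  have "wronskian u u' v v' s = 0"
  proof (rule tendsto_unique[OF _ _ lim])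
    have "eventually (\<lambda>t. wronskian u u' v v' s = wronskian u u' v v' t) (at_right 0)"
      using nz by (intro eventually_at_rightI[of 0 L] const[OF W] s) auto
    then show "(wronskian u u' v v' \<longlongrightarrow> wronskian u u' v v' s) (at_right 0)"
      by (rule Lim_transform_eventually[OF tendsto_const])
  qed simp
  then have "u' s * v s = 0" using s by (simp add: wronskian_def)
  moreover have "u' s \<noteq> 0"
  proof
    assume "u' s = 0"
    have "((\<lambda>t. (u t)\<^sup>2 + (u' t)\<^sup>2) has_real_derivative 0) (at t)" if "0 < t" "t < L" for t
      by (rule derivative_eq_intros u that refl)+ simp
    from const[OF this nz(1,2) s(1,2)] have "(u z)\<^sup>2 + (u' z)\<^sup>2 = 0"
      using s \<open>u' s = 0\<close> by simp
    then show False using nz(3) by (simp add: sum_power2_eq_zero_iff)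
  qed
  ultimately show ?thesis by simp
qed

locale jacobi_parameters =
  fixes \<alpha> \<beta> :: real
  assumes alpha: "\<alpha> > -1" and beta: "\<beta> > -1"
begin

abbreviation g :: "nat \<Rightarrow> real" where "g n \<equiv> jacobi_gamma \<alpha> \<beta> n"
abbreviation u :: "nat \<Rightarrow> real \<Rightarrow> real" where "u n \<equiv> liouville \<alpha> \<beta> (g n) (jacobi_poly \<alpha> \<beta> n)"
abbreviation u' :: "nat \<Rightarrow> real \<Rightarrow> real" where "u' n \<equiv> liouville' \<alpha> \<beta> (g n) (jacobi_poly \<alpha> \<beta> n)"
abbreviation scaled_theta :: "nat \<Rightarrow> nat \<Rightarrow> real" where "scaled_theta n k \<equiv> g n * jacobi_theta \<alpha> \<beta> n k"

lemma gamma_pos: "1 \<le> n \<Longrightarrow> 0 < g n"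
  using alpha beta by (simp add: jacobi_gamma_def field_simps)

lemma gamma_Suc: "g (Suc n) = g n + 1"
  by (simp add: jacobi_gamma_def)

lemma u_derivative:
  assumes "1 \<le> n" "0 < t" "t < g n * pi"
  shows "(u n has_real_derivative u' n t) (at t)"
  using liouville_derivative gamma_pos assms by blast

lemma u'_derivative:
  assumes "1 \<le> n" "0 < t" "t < g n * pi"
  shows "(u' n has_real_derivative - (1 + potential \<alpha> \<beta> (t / (2 * g n)) / t\<^sup>2) * u n t) (at t)"
  by (rule liouville_second_derivative[OF gamma_pos[OF assms(1)] assms(2,3)])
     (simp_all add: jacobi_gamma_def jacobi_op_jacobi_poly[OF alpha beta])

lemma u_wronskian:
  assumes "1 \<le> n" "1 \<le> m"
  shows "(wronskian (u n) (u' n) (u m) (u' m) \<longlongrightarrow> 0) (at_right 0)"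
  by (intro liouville_wronskian_tendsto_0 alpha gamma_pos assms)

lemma u_eq_0_iff:
  assumes "1 \<le> n" "0 < t" "t < g n * pi"
  shows "u n t = 0 \<longleftrightarrow> t \<in> scaled_theta n ` {1..n}"
proof -
  note g = gamma_pos[OF assms(1)]
  have "u n t = 0 \<longleftrightarrow> poly (jacobi_poly \<alpha> \<beta> n) (cos (t / g n)) = 0"
    using half_angle_pos[OF g assms(2,3)] by (simp add: liouville_def amplitude_def)
  also have "\<dots> \<longleftrightarrow> t / g n \<in> jacobi_angles \<alpha> \<beta> n"
    using assms g by (simp add: jacobi_angles_def field_simps)
  also have "\<dots> \<longleftrightarrow> t / g n \<in> jacobi_theta \<alpha> \<beta> n ` {1..n}"
    by (simp only: jacobi_theta_enumerates(2)[OF alpha beta])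
  also have "\<dots> \<longleftrightarrow> t \<in> scaled_theta n ` {1..n}"
    using g by (auto simp: image_iff field_simps)
  finally show ?thesis .
qed

lemma scaled_theta_bounds:
  assumes "1 \<le> n" "k \<in> {1..n}"
  shows "0 < scaled_theta n k" "scaled_theta n k < g n * pi"
proof -
  have "jacobi_theta \<alpha> \<beta> n k \<in> jacobi_angles \<alpha> \<beta> n"
    using jacobi_theta_enumerates(2)[OF alpha beta, of n] assms by blast
  then show "0 < scaled_theta n k" "scaled_theta n k < g n * pi"
    using gamma_pos[OF assms(1)] by (simp_all add: jacobi_angles_def)
qed

lemma u_scaled_theta:
  assumes "1 \<le> n" "k \<in> {1..n}"
  shows "u n (scaled_theta n k) = 0"
  using u_eq_0_iff scaled_theta_bounds assms by blast

lemma scaled_theta_strict_mono: "1 \<le> n \<Longrightarrow> strict_mono_on {1..n} (scaled_theta n)"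
  using jacobi_theta_enumerates(1)[OF alpha beta, of n] gamma_pos[of n]
  by (simp add: strict_mono_on_def)

lemma u_not_identically_0:
  assumes "1 \<le> n" "0 < L" "L \<le> g n * pi"
  obtains z where "0 < z" "z < L" "u n z \<noteq> 0"
proof -
  have "infinite ({0<..<L} - scaled_theta n ` {1..n})"
    using assms by (intro Diff_infinite_finite) (auto simp: infinite_Ioo)
  then obtain z where "z \<in> {0<..<L} - scaled_theta n ` {1..n}"
    using infinite_imp_nonempty by blast
  then show thesis using that[of z] u_eq_0_iff[of n z] assms by auto
qed

text \<open>
  Passing from \<open>n\<close> to \<open>n + 1\<close> increases \<open>\<gamma>\<close> and decreases \<open>t / (2 * \<gamma>)\<close>, so the potential at a fixed \<open>t\<close>
  decreases and the scaled zeros move to the right. The comparison takes place on the smaller of the two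
  domains, below \<open>g n * pi\<close>.
\<close>

lemma scaled_theta_less:
  assumes n: "1 \<le> n" and k: "k \<in> {1..n}"
    and mono: "\<And>x y. 0 < x \<Longrightarrow> x < y \<Longrightarrow> y < pi / 2 \<Longrightarrow> potential \<alpha> \<beta> x < potential \<alpha> \<beta> y"
  shows "scaled_theta n k < scaled_theta (Suc n) k"
proof -
  let ?m = "Suc n" and ?L = "g n * pi"
  have m: "1 \<le> ?m" by simp
  have Lm: "?L < g ?m * pi" by (simp add: gamma_Suc)
  have less: "1 + potential \<alpha> \<beta> (t / (2 * g ?m)) / t\<^sup>2 < 1 + potential \<alpha> \<beta> (t / (2 * g n)) / t\<^sup>2"
    if "0 < t" "t < ?L" for t
  proof -
    have "potential \<alpha> \<beta> (t / (2 * g ?m)) < potential \<alpha> \<beta> (t / (2 * g n))"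
      using that gamma_pos[OF n] by (intro mono) (auto simp: gamma_Suc field_simps)
    then show ?thesis using that by (simp add: divide_strict_right_mono)
  qed
  have zero: "\<exists>j\<in>{1..n}. a < scaled_theta n j \<and> scaled_theta n j < b"
    if ab: "0 \<le> a" "a < b" "b < ?L" "a = 0 \<or> u ?m a = 0" "u ?m b = 0"
      and nz: "\<And>t. a < t \<Longrightarrow> t < b \<Longrightarrow> u ?m t \<noteq> 0" for a b
  proof -
    have "\<exists>t. a < t \<and> t < b \<and> u n t = 0"
    proof (rule sturm_comparison[where L = ?L and v = "u ?m" and v' = "u' ?m" and u' = "u' n"
          and q = "\<lambda>t. 1 + potential \<alpha> \<beta> (t / (2 * g n)) / t\<^sup>2"
          and r = "\<lambda>t. 1 + potential \<alpha> \<beta> (t / (2 * g ?m)) / t\<^sup>2"])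
      fix t assume t: "0 < t" "t < ?L"
      have tm: "t < g ?m * pi" using t(2) Lm by (rule less_trans)
      show "(u n has_real_derivative u' n t) (at t)" by (rule u_derivative[OF n t])
      show "(u' n has_real_derivative - (1 + potential \<alpha> \<beta> (t / (2 * g n)) / t\<^sup>2) * u n t) (at t)"
        by (rule u'_derivative[OF n t])
      show "(u ?m has_real_derivative u' ?m t) (at t)" by (rule u_derivative[OF m t(1) tm])
      show "(u' ?m has_real_derivative - (1 + potential \<alpha> \<beta> (t / (2 * g ?m)) / t\<^sup>2) * u ?m t) (at t)"
        by (rule u'_derivative[OF m t(1) tm])
    qed (use less u_wronskian[OF n m] ab nz in auto)
    then obtain t where t: "a < t" "t < b" "u n t = 0" by blast
    then have "t \<in> scaled_theta n ` {1..n}" using u_eq_0_iff[OF n, of t] ab by auto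
    with t show ?thesis by blast
  qed
  have between_nz: "u ?m t \<noteq> 0"
    if i: "i \<in> {0..n}" "i = 0 \<or> scaled_theta ?m i < t" and t: "0 < t" "t < scaled_theta ?m (Suc i)" for i t
  proof
    assume "u ?m t = 0"
    moreover have "t < g ?m * pi" using i t scaled_theta_bounds(2)[OF m, of "Suc i"] by auto
    ultimately obtain j where j: "j \<in> {1..?m}" "t = scaled_theta ?m j"
      using u_eq_0_iff[OF m, of t] t(1) by blast
    have "j < Suc i"
      using i t j strict_mono_on_leD[OF scaled_theta_strict_mono[OF m], of "Suc i" j]
      by (force simp: not_less[symmetric])
    moreover have "i < j"
      using i t j strict_mono_on_leD[OF scaled_theta_strict_mono[OF m], of j i]
      by (cases "i = 0") (force simp: not_less[symmetric])+
    ultimately show False by simp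
  qed
  show ?thesis
  proof (rule interlacing_enumerations[where L = ?L and n = n and m = ?m])
    assume "scaled_theta ?m 1 < ?L"
    then show "\<exists>j\<in>{1..n}. scaled_theta n j < scaled_theta ?m 1"
      using zero[of 0 "scaled_theta ?m 1"] scaled_theta_bounds(1)[OF m, of 1]
        u_scaled_theta[OF m, of 1] between_nz[of 0] by auto
  next
    fix i assume i: "1 \<le> i" "Suc i \<le> ?m" "scaled_theta ?m (Suc i) < ?L"
    have "scaled_theta ?m i < scaled_theta ?m (Suc i)"
      using scaled_theta_strict_mono[OF m] i by (simp add: strict_mono_on_def)
    then show "\<exists>j\<in>{1..n}. scaled_theta ?m i < scaled_theta n j \<and> scaled_theta n j < scaled_theta ?m (Suc i)"
      using i scaled_theta_bounds(1)[OF m, of i] u_scaled_theta[OF m, of i] u_scaled_theta[OF m, of "Suc i"]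
      by (intro zero between_nz[of i]) auto
  qed (use scaled_theta_strict_mono n k scaled_theta_bounds in auto)
qed

text \<open>
  Both \<open>u n\<close> and \<open>u (Suc n)\<close> solve \<open>w'' + w = 0\<close>, so their zeros in the common domain coincide. Those of index
  \<open>n\<close> all lie in it, and comparing the places in the two enumerations in both directions shows that they are
  the first ones of index \<open>n + 1\<close>.
\<close>

lemma scaled_theta_eq:
  assumes n: "1 \<le> n" and k: "k \<in> {1..n}"
    and zero: "\<And>x. potential \<alpha> \<beta> x = 0"
  shows "scaled_theta n k = scaled_theta (Suc n) k"
proof -
  let ?m = "Suc n" and ?L = "g n * pi"
  have m: "1 \<le> ?m" by simp
  have Lm: "?L < g ?m * pi" by (simp add: gamma_Suc)
  have L: "0 < ?L" using gamma_pos[OF n] by simp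
  have d: "(u n has_real_derivative u' n t) (at t)" "(u' n has_real_derivative - u n t) (at t)"
      "(u ?m has_real_derivative u' ?m t) (at t)" "(u' ?m has_real_derivative - u ?m t) (at t)"
    if "0 < t" "t < ?L" for t
    using u_derivative[OF n, of t] u'_derivative[OF n, of t] u_derivative[OF m, of t]
      u'_derivative[OF m, of t] that Lm by (simp_all add: zero)
  have nm: "u ?m s = 0" if "0 < s" "s < ?L" "u n s = 0" for s
  proof -
    obtain z where "0 < z" "z < ?L" "u n z \<noteq> 0" using u_not_identically_0[OF n L] by auto
    then show ?thesis
      using common_zeros_if_same_equation[OF d u_wronskian[OF n m]] that by blast
  qed
  have mn: "u n s = 0" if "0 < s" "s < ?L" "u ?m s = 0" for s
  proof -
    obtain z where "0 < z" "z < ?L" "u ?m z \<noteq> 0" using u_not_identically_0[OF m L] Lm by auto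
    then show ?thesis
      using common_zeros_if_same_equation[OF d(3,4,1,2) u_wronskian[OF m n]] that by blast
  qed
  have le: "scaled_theta ?m k \<le> scaled_theta n k" if "k \<in> {1..n}" for k
  proof -
    have "\<exists>j\<in>{k..?m}. scaled_theta ?m j = scaled_theta n k"
    proof (rule enumeration_subset_index_ge[OF _ _ _ that])
      fix i assume i: "i \<in> {1..n}"
      have "u ?m (scaled_theta n i) = 0"
        using nm scaled_theta_bounds[OF n i] u_scaled_theta[OF n i] by blast
      then show "\<exists>j\<in>{1..?m}. scaled_theta ?m j = scaled_theta n i"
        using u_eq_0_iff[OF m] scaled_theta_bounds[OF n i] Lm by fastforce
    qed (use scaled_theta_strict_mono n in auto)
    then obtain j where "j \<in> {k..?m}" "scaled_theta ?m j = scaled_theta n k" by blast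
    moreover from this have "scaled_theta ?m k \<le> scaled_theta ?m j"
      using that by (intro strict_mono_on_leD[OF scaled_theta_strict_mono[OF m]]) auto
    ultimately show ?thesis by simp
  qed
  have ge: "scaled_theta n k \<le> scaled_theta ?m k"
  proof -
    have "\<exists>j\<in>{k..n}. scaled_theta n j = scaled_theta ?m k"
    proof (rule enumeration_subset_index_ge[OF _ _ _ k])
      show "strict_mono_on {1..n} (scaled_theta ?m)"
        using scaled_theta_strict_mono[OF m] by (auto simp: strict_mono_on_def)
    next
      fix i assume i: "i \<in> {1..n}"
      have "scaled_theta ?m i < ?L" using le[OF i] scaled_theta_bounds(2)[OF n i] by simp
      moreover have "0 < scaled_theta ?m i" "u ?m (scaled_theta ?m i) = 0"
        using scaled_theta_bounds(1)[OF m, of i] u_scaled_theta[OF m, of i] i by auto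
      ultimately have "scaled_theta ?m i \<in> scaled_theta n ` {1..n}"
        using mn u_eq_0_iff[OF n] by blast
      then show "\<exists>j\<in>{1..n}. scaled_theta n j = scaled_theta ?m i" by force
    qed (use scaled_theta_strict_mono n in auto)
    then obtain j where "j \<in> {k..n}" "scaled_theta n j = scaled_theta ?m k" by blast
    moreover from this have "scaled_theta n k \<le> scaled_theta n j"
      using k by (intro strict_mono_on_leD[OF scaled_theta_strict_mono[OF n]]) auto
    ultimately show ?thesis by simp
  qed
  show ?thesis using le[OF k] ge by simp
qed

end

theorem corollary6p2:
  fixes \<alpha> \<beta> :: real
  assumes "(\<alpha>, \<beta>) \<in> D_up"
  shows "(\<forall>n\<ge>1. \<forall>k\<in>{1..n}.
            jacobi_gamma \<alpha> \<beta> n * jacobi_theta \<alpha> \<beta> n k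
              \<le> jacobi_gamma \<alpha> \<beta> (n + 1) * jacobi_theta \<alpha> \<beta> (n + 1) k)
       \<and> ((\<exists>n\<ge>1. \<exists>k\<in>{1..n}.
            jacobi_gamma \<alpha> \<beta> n * jacobi_theta \<alpha> \<beta> n k
              = jacobi_gamma \<alpha> \<beta> (n + 1) * jacobi_theta \<alpha> \<beta> (n + 1) k)
          \<longleftrightarrow> \<bar>\<alpha>\<bar> = 1/2 \<and> \<bar>\<beta>\<bar> = 1/2)
       \<and> (\<bar>\<alpha>\<bar> = 1/2 \<and> \<bar>\<beta>\<bar> = 1/2 \<longrightarrow>
            (\<forall>n\<ge>1. \<forall>k\<in>{1..n}.
               jacobi_gamma \<alpha> \<beta> n * jacobi_theta \<alpha> \<beta> n k
                 = jacobi_gamma \<alpha> \<beta> (n + 1) * jacobi_theta \<alpha> \<beta> (n + 1) k))"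
proof -
  have D: "\<alpha> > -1" "\<beta> > -1" "\<bar>\<beta>\<bar> \<le> 1/2" "\<alpha>\<^sup>2 + 3 * \<beta>\<^sup>2 \<le> 1"
    using assms by (auto simp: D_up_def)
  interpret jacobi_parameters \<alpha> \<beta> by unfold_locales (use D in auto)
  show ?thesis
  proof (cases "\<bar>\<alpha>\<bar> = 1/2 \<and> \<bar>\<beta>\<bar> = 1/2")
    case True
    have sq: "x\<^sup>2 = 1/4" if "\<bar>x\<bar> = 1/2" for x :: real
    proof -
      have "\<bar>x\<bar> * \<bar>x\<bar> = 1/2 * (1/2)" by (simp only: that)
      then show ?thesis by (simp add: power2_eq_square)
    qed
    have ab: "\<alpha>\<^sup>2 = 1/4" "\<beta>\<^sup>2 = 1/4"
      using sq[OF conjunct1[OF True]] sq[OF conjunct2[OF True]] .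
    have zero: "potential \<alpha> \<beta> x = 0" for x unfolding potential_def ab by simp
    have eq: "scaled_theta n k = scaled_theta (n + 1) k" if "1 \<le> n" "k \<in> {1..n}" for n k
      using scaled_theta_eq[OF that zero] by (simp only: Suc_eq_plus1)
    have ex: "\<exists>n\<ge>1. \<exists>k\<in>{1..n}. scaled_theta n k = scaled_theta (n + 1) k"
      by (intro exI[of _ 1] bexI[of _ 1] conjI eq) auto
    have all: "\<forall>n\<ge>1. \<forall>k\<in>{1..n}. scaled_theta n k = scaled_theta (n + 1) k"
      using eq by blast
    have le: "\<forall>n\<ge>1. \<forall>k\<in>{1..n}. scaled_theta n k \<le> scaled_theta (n + 1) k"
      using eq_refl[OF eq] by blast
    have "P \<and> (Q \<longleftrightarrow> R) \<and> (R \<longrightarrow> S)" if P Q R S for P Q R S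
      using that by simp
    from this[OF le ex True all] show ?thesis .
  next
    case False
    have less: "scaled_theta n k < scaled_theta (n + 1) k" if "1 \<le> n" "k \<in> {1..n}" for n k
      using scaled_theta_less[OF that potential_strict_mono[OF D(3,4) False]] by simp
    have nex: "\<not> (\<exists>n\<ge>1. \<exists>k\<in>{1..n}. scaled_theta n k = scaled_theta (n + 1) k)"
    proof (intro notI, elim exE conjE bexE)
      fix n k assume "1 \<le> n" "k \<in> {1..n}" "scaled_theta n k = scaled_theta (n + 1) k"
      then show False using less[of n k] by linarith
    qed
    have le: "\<forall>n\<ge>1. \<forall>k\<in>{1..n}. scaled_theta n k \<le> scaled_theta (n + 1) k"
      using less_imp_le[OF less] by blast
    have "P \<and> (Q \<longleftrightarrow> R) \<and> (R \<longrightarrow> S)" if P "\<not> Q" "\<not> R" for P Q R S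
      using that by simp
    from this[OF le nex False] show ?thesis .
  qed
qed

end
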